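(* Let $\mathbf{Q}^{(1)},\dots,\mathbf{Q}^{(n)}\in\mathbb{K}^{m\times m}$ be symmetric (negated) Metzler matrices, let $\mathcal{S}_{\mathbb K}=\{\mathbf{x}\in\mathbb{K}_{\ge 0}^n : \mathbf{x}_1\mathbf{Q}^{(1)}+\dots+\mathbf{x}_n\mathbf{Q}^{(n)}\succeq 0\}$, and let $Q^{(k)}=\mathrm{sval}(\mathbf{Q}^{(k)})\in\mathbb{T}_\pm^{m\times m}$ for $k\in[n]$. Suppose that for every $k\in[n]$ and every pair $i\ne j$ in $[m]$ such that $Q^{(k)}_{ii}$ and $Q^{(k)}_{jj}$ both belong to $\mathbb{T}_+$, we have $Q^{(k)}_{ii}+Q^{(k)}_{jj}\neq 2|Q^{(k)}_{ij}|$, and suppose that every stratum of the set $\mathcal{S}(Q^{(1)},\dots,Q^{(n)})$ is regular. Then $\mathrm{val}(\mathcal{S}_{\mathbb K})=\mathcal{S}(Q^{(1)},\dots,Q^{(n)})$.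
   Context: $[k]=\{1,\dots,k\}$. $\mathbb{K}$ is the field of formal generalized real Puiseux series: series $\mathbf{x}=\sum_{i\ge 1}c_{\lambda_i}t^{\lambda_i}$ where $(\lambda_i)$ is a strictly decreasing sequence of real numbers that is either finite or unbounded and $c_{\lambda_i}\in\mathbb{R}\setminus\{0\}$, together with the empty series $0$, with the natural addition and multiplication. The leading coefficient is $\mathrm{lc}(\mathbf{x})=c_{\lambda_1}$, $\mathrm{lc}(0)=0$; $\mathbb{K}$ is ordered by $\mathbf{x}\ge\mathbf{y}$ iff $\mathrm{lc}(\mathbf{x}-\mathbf{y})\ge 0$, and is a real closed field. $\mathbb{K}_{\ge0}$ is the set of nonnegative elements. $\succeq 0$ means positive semidefinite over $\mathbb{K}$. The valuation is $\mathrm{val}(\mathbf{x})=\lambda_1$, $\mathrm{val}(0)=-\infty$. A square matrix over $\mathbb{K}$ is a (negated) Metzler matrix if all its off-diagonal entries are nonpositive. $\mathbb{T}=\mathbb{R}\cup\{-\infty\}$ with its usual order and addition ($-\infty$ absorbing). $\mathbb{T}_\pm$ is the set of signed tropical numbers: pairs $(1,a)$ (written $a$; the set of these is $\mathbb{T}_+$), pairs $(-1,a)$ (written $\ominus a$; the set of these is $\mathbb{T}_-$), with $a\in\mathbb{R}$, and $-\infty$ (sign $0$). Modulus: $|a|=|\ominus a|=a$ and $|-\infty|=-\infty$. The signed valuation is $\mathrm{sval}(\mathbf{x})=(\mathrm{sign}(\mathbf{x}),\mathrm{val}(\mathbf{x}))\in\mathbb{T}_\pm$. $\mathrm{val}$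 and $\mathrm{sval}$ are applied entrywise. A matrix over $\mathbb{T}_\pm$ is tropical Metzler if its off-diagonal entries lie in $\mathbb{T}_-\cup\{-\infty\}$. For symmetric tropical Metzler $Q^{(1)},\dots,Q^{(n)}\in\mathbb{T}_\pm^{m\times m}$, $\mathcal{S}(Q^{(1)},\dots,Q^{(n)})$ is the set of $x\in\mathbb{T}^n$ such that: for all $i\in[m]$, $Q^+_{ii}(x)\ge Q^-_{ii}(x)$; and for all $i<j$ in $[m]$, $Q^+_{ii}(x)+Q^+_{jj}(x)\ge 2\max_{k\in[n]}(|Q^{(k)}_{ij}|+x_k)$. Here $Q^+_{ii}(x)=\max\{Q^{(k)}_{ii}+x_k : Q^{(k)}_{ii}\in\mathbb{T}_+\}$ and $Q^-_{ii}(x)=\max\{|Q^{(k)}_{ii}|+x_k : Q^{(k)}_{ii}\in\mathbb{T}_-\}$, with $\max\emptyset=-\infty$. The support of $x\in\mathbb{T}^n$ is $\{k: x_k\ne-\infty\}$. For nonempty $K\subset[n]$, the stratum of $S\subset\mathbb{T}^n$ associated with $K$ is the set of $(x_k)_{k\in K}\in\mathbb{R}^K$ for $x\in S$ with support exactly $K$. A set $S\subset\mathbb{R}^p$ is regular if it is closed and $S=\mathrm{cl}(\mathrm{int}(S))$ (Euclidean topology). *)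

theory Defs
  imports "HOL-Analysis.Analysis"
begin

section \<open>Generalized real Puiseux series\<close>

text \<open>
  A series is represented by its coefficient function.  The support of a series is the set of
  values of a strictly decreasing sequence of reals that is either finite or unbounded (possibly
  the empty sequence); this means exactly that only finitely many exponents lie above any given
  bound, see \<open>finite_above_iff_sequence\<close>.
\<close>

typedef gpuiseux = "{f :: real \<Rightarrow> real. \<forall>b. finite {l. b \<le> l \<and> f l \<noteq> 0}}"
  morphisms coeff Abs_gpuiseux
  by (rule exI[of _ "\<lambda>_. 0"]) simp

setup_lifting type_definition_gpuiseux

lemma finite_above_iff_sequence:
  fixes A :: "real set"
  shows "(\<forall>b. finite {l. b \<le> l \<and> l \<in> A}) \<longleftrightarrow>
    finite A \<or> (\<exists>s :: nat \<Rightarrow> real. (\<forall>i j. i < j \<longrightarrow> s j < s i) \<and> \<not> bdd_below (range s) \<and> A = range s)"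
    (is "?L \<longleftrightarrow> ?R")
proof
  assume ?R
  then show ?L
  proof
    assume "finite A" then show ?L by simp
  next
    assume "\<exists>s :: nat \<Rightarrow> real. (\<forall>i j. i < j \<longrightarrow> s j < s i) \<and> \<not> bdd_below (range s) \<and> A = range s"
    then obtain s :: "nat \<Rightarrow> real" where dec: "\<And>i j. i < j \<Longrightarrow> s j < s i"
      and unb: "\<not> bdd_below (range s)" and A: "A = range s" by (elim exE conjE) metis
    show ?L
    proof
      fix b
      obtain n where n: "s n < b" using unb unfolding bdd_below_def by (metis not_le rangeE)
      have "{l. b \<le> l \<and> l \<in> A} \<subseteq> s ` {..n}"
      proof
        fix l assume "l \<in> {l. b \<le> l \<and> l \<in> A}"
        then obtain i where i: "l = s i" "b \<le> s i" using A by auto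
        have "i \<le> n" using dec[of n i] n i by (metis less_trans not_le order_less_le_trans less_irrefl)
        then show "l \<in> s ` {..n}" using i by auto
      qed
      then show "finite {l. b \<le> l \<and> l \<in> A}" by (rule finite_subset) simp
    qed
  qed
next
  assume L: ?L
  have ex: "\<exists>m\<in>A. m < c \<and> (\<forall>l\<in>A. l < c \<longrightarrow> l \<le> m)" if inf: "infinite A" for c
  proof -
    have "\<not> A \<subseteq> {l. c \<le> l \<and> l \<in> A}" using L inf finite_subset by blast
    then obtain a where a: "a \<in> A" "a < c" using not_le by blast
    let ?B = "{l. a \<le> l \<and> l \<in> A} \<inter> {..<c}"
    have f: "finite ?B" using L by blast
    have ne: "?B \<noteq> {}" using a by auto
    show ?thesis
    proof (intro bexI conjI ballI impI)
      show "Max ?B \<in> A" "Max ?B < c" using Max_in[OF f ne] by auto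
      fix l assume l: "l \<in> A" "l < c"
      show "l \<le> Max ?B"
      proof (cases "a \<le> l")
        case True then show ?thesis using l f by (intro Max_ge) auto
      next
        case False
        have "a \<le> Max ?B" using a f by (intro Max_ge) auto
        then show ?thesis using False by linarith
      qed
    qed
  qed
  show ?R
  proof (cases "finite A")
    case inf: False
    define P where "P = (\<lambda>c m. m \<in> A \<and> m < c \<and> (\<forall>l\<in>A. l < c \<longrightarrow> l \<le> m))"
    define g where "g = (\<lambda>c. SOME m. P c m)"
    have g: "P c (g c)" for c
      unfolding g_def by (rule someI_ex) (use ex[OF inf, of c] P_def in blast)
    obtain u where u: "\<And>l. l \<in> A \<Longrightarrow> l < u"
    proof -
      have f: "finite {l. 0 \<le> l \<and> l \<in> A}" using L by blast
      define u where "u = Max (insert 0 {l. 0 \<le> l \<and> l \<in> A}) + 1"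
      have "l < u" if "l \<in> A" for l
      proof -
        have "(0::real) \<le> Max (insert 0 {l. 0 \<le> l \<and> l \<in> A})" using f by (intro Max_ge) auto
        moreover have "l \<le> Max (insert 0 {l. 0 \<le> l \<and> l \<in> A})" if "0 \<le> l"
          using f that \<open>l \<in> A\<close> by (intro Max_ge) auto
        ultimately show ?thesis unfolding u_def by fastforce
      qed
      then show ?thesis using that by blast
    qed
    define s where "s = (\<lambda>n. (g ^^ Suc n) u)"
    have s0: "s 0 = g u" and sS: "\<And>n. s (Suc n) = g (s n)" by (simp_all add: s_def)
    have step: "s (Suc n) < s n" for n using g[of "s n"] by (simp add: sS P_def)
    have dec: "s j < s i" if "i < j" for i j
      using that by (induction rule: strict_inc_induct) (use step less_trans in blast)+
    have inA: "s n \<in> A" for n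
      using g[of u] g[of "s (n - 1)"] by (cases n) (auto simp: s0 sS P_def)
    have injs: "inj s" by (rule injI) (metis dec less_irrefl linorder_neqE_nat)
    have unb: "\<exists>n. s n < b" for b
    proof (rule ccontr)
      assume "\<nexists>n. s n < b"
      then have "range s \<subseteq> {l. b \<le> l \<and> l \<in> A}" using inA by (auto simp: not_less)
      then have "finite (range s)" using L finite_subset by blast
      then show False using injs finite_imageD by blast
    qed
    have "A \<subseteq> range s"
    proof
      fix a assume a: "a \<in> A"
      show "a \<in> range s"
      proof (rule ccontr)
        assume na: "a \<notin> range s"
        have "a < s n" for n
        proof (induction n)
          case 0
          have "a \<le> s 0" using g[of u] a u by (auto simp: s0 P_def)
          then show ?case using na by (metis order_le_less rangeI)
        next
          case (Suc n)
          then have "a \<le> s (Suc n)" using g[of "s n"] a by (auto simp: sS P_def)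
          then show ?case using na by (metis order_le_less rangeI)
        qed
        then show False using unb[of a] by (metis less_asym)
      qed
    qed
    then have "A = range s" using inA by auto
    moreover have "\<not> bdd_below (range s)"
      unfolding bdd_below_def using unb by (metis not_le rangeI)
    ultimately show ?thesis using dec by (intro disjI2 exI[of _ s]) auto
  qed simp
qed

lemma finite_coeff: "finite {l. b \<le> l \<and> coeff f l \<noteq> 0}"
  using coeff[of f] by simp

lemma coeff_bound:
  obtains u where "\<And>l. coeff f l \<noteq> 0 \<Longrightarrow> l \<le> u"
proof -
  define S where "S = insert 0 {l. 0 \<le> l \<and> coeff f l \<noteq> 0}"
  have f: "finite S" unfolding S_def using finite_coeff[of 0 f] by simp
  have "l \<le> Max S" if "coeff f l \<noteq> 0" for l
  proof -
    have "0 \<le> Max S" using f by (intro Max_ge) (auto simp: S_def)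
    moreover have "l \<le> Max S" if "0 \<le> l"
      using f that \<open>coeff f l \<noteq> 0\<close> by (intro Max_ge) (auto simp: S_def)
    ultimately show ?thesis by fastforce
  qed
  then show ?thesis using that by blast
qed

lemma gpuiseux_eqI: "(\<And>l. coeff f l = coeff g l) \<Longrightarrow> f = g"
  by (metis coeff_inject ext)

lemma finite_convolution_aux:
  assumes "\<And>b. finite {l. b \<le> l \<and> f l \<noteq> 0}" "\<And>b. finite {l. b \<le> l \<and> g l \<noteq> 0}"
  shows "finite {l :: real. b \<le> l \<and>
           (\<Sum>m | f m \<noteq> 0 \<and> g (l - m) \<noteq> 0. f m * g (l - m) :: real) \<noteq> 0}"
proof -
  obtain u where u: "\<And>l. coeff (Abs_gpuiseux f) l \<noteq> 0 \<Longrightarrow> l \<le> u" using coeff_bound by blast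
  obtain v where v: "\<And>l. coeff (Abs_gpuiseux g) l \<noteq> 0 \<Longrightarrow> l \<le> v" using coeff_bound by blast
  have u: "f l \<noteq> 0 \<Longrightarrow> l \<le> u" for l using u assms by (simp add: Abs_gpuiseux_inverse)
  have v: "g l \<noteq> 0 \<Longrightarrow> l \<le> v" for l using v assms by (simp add: Abs_gpuiseux_inverse)
  let ?A = "{l. b - v \<le> l \<and> f l \<noteq> 0}" and ?B = "{l. b - u \<le> l \<and> g l \<noteq> 0}"
  have "{l. b \<le> l \<and> (\<Sum>m | f m \<noteq> 0 \<and> g (l - m) \<noteq> 0. f m * g (l - m)) \<noteq> 0}
        \<subseteq> (\<lambda>(x, y). x + y) ` (?A \<times> ?B)"
  proof
    fix l assume "l \<in> {l. b \<le> l \<and> (\<Sum>m | f m \<noteq> 0 \<and> g (l - m) \<noteq> 0. f m * g (l - m)) \<noteq> 0}"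
    then have l: "b \<le> l" and "(\<Sum>m | f m \<noteq> 0 \<and> g (l - m) \<noteq> 0. f m * g (l - m)) \<noteq> 0" by auto
    then obtain m where m: "f m \<noteq> 0" "g (l - m) \<noteq> 0"
      using sum.not_neutral_contains_not_neutral by force
    have "m \<in> ?A" "l - m \<in> ?B" using l m u[OF m(1)] v[OF m(2)] by auto
    then show "l \<in> (\<lambda>(x, y). x + y) ` (?A \<times> ?B)" by (intro image_eqI[of _ _ "(m, l - m)"]) auto
  qed
  then show ?thesis using assms finite_subset by blast
qed

instantiation gpuiseux :: comm_ring_1
begin

lift_definition zero_gpuiseux :: gpuiseux is "\<lambda>_. 0" by simp

lift_definition one_gpuiseux :: gpuiseux is "\<lambda>l. if l = 0 then 1 else 0"
  by (rule finite_subset[of _ "{0}"]) auto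

lift_definition plus_gpuiseux :: "gpuiseux \<Rightarrow> gpuiseux \<Rightarrow> gpuiseux" is "\<lambda>f g l. f l + g l"
proof -
  fix f g :: "real \<Rightarrow> real" and b
  assume "\<And>b. finite {l. b \<le> l \<and> f l \<noteq> 0}" "\<And>b. finite {l. b \<le> l \<and> g l \<noteq> 0}"
  then have "finite ({l. b \<le> l \<and> f l \<noteq> 0} \<union> {l. b \<le> l \<and> g l \<noteq> 0})" by simp
  then show "finite {l. b \<le> l \<and> f l + g l \<noteq> 0}" by (rule rev_finite_subset) auto
qed

lift_definition uminus_gpuiseux :: "gpuiseux \<Rightarrow> gpuiseux" is "\<lambda>f l. - f l" by simp

lift_definition minus_gpuiseux :: "gpuiseux \<Rightarrow> gpuiseux \<Rightarrow> gpuiseux" is "\<lambda>f g l. f l - g l"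
proof -
  fix f g :: "real \<Rightarrow> real" and b
  assume "\<And>b. finite {l. b \<le> l \<and> f l \<noteq> 0}" "\<And>b. finite {l. b \<le> l \<and> g l \<noteq> 0}"
  then have "finite ({l. b \<le> l \<and> f l \<noteq> 0} \<union> {l. b \<le> l \<and> g l \<noteq> 0})" by simp
  then show "finite {l. b \<le> l \<and> f l - g l \<noteq> 0}" by (rule rev_finite_subset) auto
qed

lift_definition times_gpuiseux :: "gpuiseux \<Rightarrow> gpuiseux \<Rightarrow> gpuiseux"
  is "\<lambda>f g l. \<Sum>m | f m \<noteq> 0 \<and> g (l - m) \<noteq> 0. f m * g (l - m)"
  using finite_convolution_aux by blast

lemma coeff_mult:
  assumes "finite A" "\<And>m. coeff f m \<noteq> 0 \<Longrightarrow> coeff g (l - m) \<noteq> 0 \<Longrightarrow> m \<in> A"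
  shows "coeff (f * g) l = (\<Sum>m\<in>A. coeff f m * coeff g (l - m))"
  unfolding times_gpuiseux.rep_eq
  by (rule sum.mono_neutral_left) (use assms in auto)

lemma coeff_multE:
  assumes "coeff (f * g) l \<noteq> 0"
  obtains m where "coeff f m \<noteq> 0" "coeff g (l - m) \<noteq> 0"
proof -
  have "{m. coeff f m \<noteq> 0 \<and> coeff g (l - m) \<noteq> 0} \<noteq> {}"
  proof
    assume "{m. coeff f m \<noteq> 0 \<and> coeff g (l - m) \<noteq> 0} = {}"
    then show False using assms unfolding times_gpuiseux.rep_eq by (simp only: sum.empty)
  qed
  then show ?thesis using that by blast
qed

lemma mult_mem:
  assumes "coeff f m \<noteq> 0" "coeff g (l - m) \<noteq> 0" "\<And>k. coeff g k \<noteq> 0 \<Longrightarrow> k \<le> u" "b \<le> l - u"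
  shows "m \<in> {m. b \<le> m \<and> coeff f m \<noteq> 0}"
proof -
  have "l - m \<le> u" using assms(2,3) by blast
  then show ?thesis using assms(1,4) by simp
qed

lemma mult_commute_gpuiseux: "f * g = g * (f :: gpuiseux)"
proof (rule gpuiseux_eqI)
  fix l
  show "coeff (f * g) l = coeff (g * f) l"
    unfolding times_gpuiseux.rep_eq
    by (rule sum.reindex_bij_witness[of _ "\<lambda>m. l - m" "\<lambda>m. l - m"]) auto
qed

instance
proof
  fix f g h :: gpuiseux
  show "f + g + h = f + (g + h)" by transfer (simp add: add.assoc)
  show "f + g = g + f" by transfer (simp add: add.commute)
  show "0 + f = f" by transfer simp
  show "- f + f = 0" by transfer simp
  show "f - g = f + - g" by transfer simp
  show "(0::gpuiseux) \<noteq> 1" by transfer (metis zero_neq_one)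
  show "f * g = g * f" by (rule mult_commute_gpuiseux)
  show "1 * f = f"
  proof (rule gpuiseux_eqI)
    fix l
    have "coeff (1 * f) l = (\<Sum>m\<in>{0}. coeff 1 m * coeff f (l - m))"
      by (rule coeff_mult) (auto simp: one_gpuiseux.rep_eq split: if_splits)
    then show "coeff (1 * f) l = coeff f l" by (simp add: one_gpuiseux.rep_eq)
  qed
  show "(f + g) * h = f * h + g * h"
  proof (rule gpuiseux_eqI)
    fix l
    obtain u where u: "\<And>l. coeff h l \<noteq> 0 \<Longrightarrow> l \<le> u" using coeff_bound by blast
    define A where "A = {m. l - u \<le> m \<and> coeff f m \<noteq> 0} \<union> {m. l - u \<le> m \<and> coeff g m \<noteq> 0}"
    have fin: "finite A" unfolding A_def using finite_coeff by blast
    have A: "m \<in> A" if "coeff f m \<noteq> 0 \<or> coeff g m \<noteq> 0" "coeff h (l - m) \<noteq> 0" for m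
      using that(1) mult_mem[of _ m h l u "l - u", OF _ that(2) u] unfolding A_def by blast
    have "coeff (f * h) l = (\<Sum>m\<in>A. coeff f m * coeff h (l - m))"
      by (rule coeff_mult[OF fin]) (simp add: A)
    moreover have "coeff (g * h) l = (\<Sum>m\<in>A. coeff g m * coeff h (l - m))"
      by (rule coeff_mult[OF fin]) (simp add: A)
    moreover have "coeff ((f + g) * h) l = (\<Sum>m\<in>A. coeff (f + g) m * coeff h (l - m))"
    proof (rule coeff_mult[OF fin])
      fix m assume "coeff (f + g) m \<noteq> 0" "coeff h (l - m) \<noteq> 0"
      then show "m \<in> A" using A[of m] by (auto simp: plus_gpuiseux.rep_eq)
    qed
    ultimately show "coeff ((f + g) * h) l = coeff (f * h + g * h) l"
      by (simp add: plus_gpuiseux.rep_eq sum.distrib algebra_simps)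
  qed
  show "f * g * h = f * (g * h)"
  proof (rule gpuiseux_eqI)
    fix l
    obtain u where u: "\<And>l. coeff f l \<noteq> 0 \<Longrightarrow> l \<le> u" using coeff_bound by blast
    obtain v where v: "\<And>l. coeff g l \<noteq> 0 \<Longrightarrow> l \<le> v" using coeff_bound by blast
    obtain w where w: "\<And>l. coeff h l \<noteq> 0 \<Longrightarrow> l \<le> w" using coeff_bound by blast
    have fg: "k \<le> u + v" if nz: "coeff (f * g) k \<noteq> 0" for k
    proof -
      obtain m where "coeff f m \<noteq> 0" "coeff g (k - m) \<noteq> 0"
        by (rule coeff_multE[OF nz])
      then show "k \<le> u + v" using u[of m] v[of "k - m"] by simp
    qed
    have gh: "k \<le> v + w" if nz: "coeff (g * h) k \<noteq> 0" for k
    proof -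
      obtain m where "coeff g m \<noteq> 0" "coeff h (k - m) \<noteq> 0"
        by (rule coeff_multE[OF nz])
      then show "k \<le> v + w" using v[of m] w[of "k - m"] by simp
    qed
    define A where "A = {m. l - (v + w) \<le> m \<and> coeff f m \<noteq> 0}"
    define C where "C = {m. l - (u + v) \<le> m \<and> coeff h m \<noteq> 0}"
    have fin: "finite A" "finite C" unfolding A_def C_def by (rule finite_coeff)+
    have 1: "coeff (f * g) (l - r) = (\<Sum>m\<in>A. coeff f m * coeff g (l - r - m))" if "r \<in> C" for r
    proof (rule coeff_mult[OF fin(1)])
      fix m assume m: "coeff f m \<noteq> 0" "coeff g (l - r - m) \<noteq> 0"
      show "m \<in> A" unfolding A_def
        by (rule mult_mem[OF m v]) (use that w[of r] in \<open>auto simp: C_def\<close>)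
    qed
    have 2: "coeff (h * g) (l - m) = (\<Sum>r\<in>C. coeff h r * coeff g (l - m - r))" if "m \<in> A" for m
    proof (rule coeff_mult[OF fin(2)])
      fix r assume r: "coeff h r \<noteq> 0" "coeff g (l - m - r) \<noteq> 0"
      show "r \<in> C" unfolding C_def
        by (rule mult_mem[OF r v]) (use that u[of m] in \<open>auto simp: A_def\<close>)
    qed
    have "coeff (f * g * h) l = coeff (h * (f * g)) l" by (simp only: mult_commute_gpuiseux)
    also have "\<dots> = (\<Sum>r\<in>C. coeff h r * coeff (f * g) (l - r))"
    proof (rule coeff_mult[OF fin(2)])
      fix r assume r: "coeff h r \<noteq> 0" "coeff (f * g) (l - r) \<noteq> 0"
      show "r \<in> C" unfolding C_def by (rule mult_mem[OF r fg]) auto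
    qed
    also have "\<dots> = (\<Sum>r\<in>C. \<Sum>m\<in>A. coeff h r * (coeff f m * coeff g (l - r - m)))"
      by (rule sum.cong[OF refl]) (simp add: 1 sum_distrib_left)
    also have "\<dots> = (\<Sum>m\<in>A. \<Sum>r\<in>C. coeff f m * (coeff h r * coeff g (l - m - r)))"
      by (subst sum.swap) (simp add: algebra_simps)
    also have "\<dots> = (\<Sum>m\<in>A. coeff f m * coeff (h * g) (l - m))"
      by (rule sum.cong[OF refl]) (simp add: 2 sum_distrib_left)
    also have "\<dots> = coeff (f * (h * g)) l"
    proof (rule coeff_mult[symmetric, OF fin(1)])
      fix m assume m: "coeff f m \<noteq> 0" "coeff (h * g) (l - m) \<noteq> 0"
      show "m \<in> A" unfolding A_def
        by (rule mult_mem[OF m(1) m(2)[unfolded mult_commute_gpuiseux[of h g]] gh]) auto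
    qed
    finally show "coeff (f * g * h) l = coeff (f * (g * h)) l"
      by (simp only: mult_commute_gpuiseux[of h g])
  qed
qed

end

definition lead_exp :: "gpuiseux \<Rightarrow> real" where
  "lead_exp x = (GREATEST l. coeff x l \<noteq> 0)"

definition lc :: "gpuiseux \<Rightarrow> real" where
  "lc x = (if x = 0 then 0 else coeff x (lead_exp x))"

lemma lead_exp_eq:
  assumes "coeff x l \<noteq> 0" "\<And>m. l < m \<Longrightarrow> coeff x m = 0"
  shows "lead_exp x = l"
  unfolding lead_exp_def
  by (rule Greatest_equality) (use assms not_le in blast)+

lemma lead_exp_props:
  assumes "x \<noteq> 0"
  shows "coeff x (lead_exp x) \<noteq> 0" and "lead_exp x < m \<Longrightarrow> coeff x m = 0"
proof -
  obtain a where a: "coeff x a \<noteq> 0"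
    using assms gpuiseux_eqI[of x 0] by (auto simp: zero_gpuiseux.rep_eq)
  define S where "S = {l. a \<le> l \<and> coeff x l \<noteq> 0}"
  have S_iff: "m \<in> S \<longleftrightarrow> a \<le> m \<and> coeff x m \<noteq> 0" for m by (simp add: S_def)
  have f: "finite S" and ne: "S \<noteq> {}" unfolding S_def using finite_coeff a by auto
  have in_S: "Max S \<in> S" using Max_in[OF f ne] .
  have up: "coeff x m = 0" if "Max S < m" for m
  proof (rule ccontr)
    assume "coeff x m \<noteq> 0"
    then have "m \<in> S" using that in_S S_iff by (meson less_imp_le order_trans)
    then show False using Max_ge[OF f, of m] that by simp
  qed
  have eq: "lead_exp x = Max S" 
  proof (rule lead_exp_eq)
    show "coeff x (Max S) \<noteq> 0" using in_S S_iff by blast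
  qed (rule up)
  show "coeff x (lead_exp x) \<noteq> 0" using in_S S_iff unfolding eq by blast
  show "lead_exp x < m \<Longrightarrow> coeff x m = 0" using up by (simp add: eq)
qed

lemma lc_eqI:
  assumes "coeff x l \<noteq> 0" "\<And>m. l < m \<Longrightarrow> coeff x m = 0"
  shows "lc x = coeff x l"
proof -
  have "x \<noteq> 0" using assms(1) by (auto simp: zero_gpuiseux.rep_eq)
  then show ?thesis using lead_exp_eq[OF assms] by (simp add: lc_def)
qed

lemma lc_eq_0_iff: "lc x = 0 \<longleftrightarrow> x = 0"
  using lead_exp_props(1) by (auto simp: lc_def)

lemma lc_uminus: "lc (- x) = - lc x"
proof (cases "x = 0")
  case False
  have "lc (- x) = coeff (- x) (lead_exp x)"
    by (rule lc_eqI) (use lead_exp_props[OF False] in \<open>auto simp: uminus_gpuiseux.rep_eq\<close>)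
  then show ?thesis using False by (simp add: lc_def uminus_gpuiseux.rep_eq)
qed (simp add: lc_def)

lemma lc_add_pos:
  assumes "lc x > 0" "lc y > 0"
  shows "lc (x + y) > 0"
proof -
  have aux: "lc (x + y) > 0" if "lc x > 0" "lc y > 0" "lead_exp y \<le> lead_exp x" for x y
  proof -
    have nz: "x \<noteq> 0" "y \<noteq> 0" using that by (auto simp: lc_def)
    have cx: "coeff x (lead_exp x) > 0" and cy: "coeff y (lead_exp y) > 0"
      using that nz by (auto simp: lc_def)
    have "coeff y (lead_exp x) \<ge> 0"
      using that(3) cy lead_exp_props(2)[OF nz(2), of "lead_exp x"] by (cases "lead_exp x = lead_exp y") auto
    then have p: "coeff (x + y) (lead_exp x) > 0" using cx by (simp add: plus_gpuiseux.rep_eq)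
    have "lc (x + y) = coeff (x + y) (lead_exp x)"
      by (rule lc_eqI) (use p that(3) lead_exp_props(2)[OF nz(1)] lead_exp_props(2)[OF nz(2)]
          in \<open>auto simp: plus_gpuiseux.rep_eq\<close>)
    then show ?thesis using p by simp
  qed
  show ?thesis
    using aux[OF assms] aux[OF assms(2,1)] by (cases "lead_exp y \<le> lead_exp x") (auto simp: add.commute)
qed

lemma coeff_mult_lead:
  assumes "x \<noteq> 0" "y \<noteq> 0"
  shows "coeff (x * y) (lead_exp x + lead_exp y) = lc x * lc y"
    and "lead_exp x + lead_exp y < m \<Longrightarrow> coeff (x * y) m = 0"
proof -
  have "coeff (x * y) (lead_exp x + lead_exp y) =
      (\<Sum>l\<in>{lead_exp x}. coeff x l * coeff y (lead_exp x + lead_exp y - l))"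
  proof (rule coeff_mult)
    fix k assume "coeff x k \<noteq> 0" "coeff y (lead_exp x + lead_exp y - k) \<noteq> 0"
    then have "k \<le> lead_exp x" "lead_exp x + lead_exp y - k \<le> lead_exp y"
      using lead_exp_props(2)[OF assms(1)] lead_exp_props(2)[OF assms(2)] by (meson not_le)+
    then show "k \<in> {lead_exp x}" by simp
  qed simp
  then show "coeff (x * y) (lead_exp x + lead_exp y) = lc x * lc y"
    using assms by (simp add: lc_def)
  assume m: "lead_exp x + lead_exp y < m"
  have "coeff (x * y) m = (\<Sum>l\<in>{}. coeff x l * coeff y (m - l))"
  proof (rule coeff_mult)
    fix k assume "coeff x k \<noteq> 0" "coeff y (m - k) \<noteq> 0"
    then have "k \<le> lead_exp x" "m - k \<le> lead_exp y"
      using lead_exp_props(2)[OF assms(1)] lead_exp_props(2)[OF assms(2)] by (meson not_le)+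
    then show "k \<in> {}" using m by simp
  qed simp
  then show "coeff (x * y) m = 0" by simp
qed

lemma lc_mult: "lc (x * y) = lc x * lc y"
proof (cases "x = 0 \<or> y = 0")
  case False
  then have nz: "x \<noteq> 0" "y \<noteq> 0" by auto
  have "lc (x * y) = coeff (x * y) (lead_exp x + lead_exp y)"
    by (rule lc_eqI) (use coeff_mult_lead[OF nz] nz lc_eq_0_iff in auto)
  then show ?thesis using coeff_mult_lead(1)[OF nz] by simp
qed (auto simp: lc_def)

lift_definition monomial :: "real \<Rightarrow> real \<Rightarrow> gpuiseux" is "\<lambda>c e l. if l = e then c else 0"
proof -
  fix c e b :: real
  show "finite {l. b \<le> l \<and> (if l = e then c else 0) \<noteq> 0}"
    by (rule finite_subset[of _ "{e}"]) auto
qed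

lemma coeff_monomial_mult: "coeff (monomial c e * x) l = c * coeff x (l - e)"
proof -
  have "coeff (monomial c e * x) l = (\<Sum>m\<in>{e}. coeff (monomial c e) m * coeff x (l - m))"
    by (rule coeff_mult) (auto simp: monomial.rep_eq split: if_splits)
  then show ?thesis by (simp add: monomial.rep_eq)
qed

lemma coeff_mult_cong_above:
  assumes "\<And>m. coeff x m \<noteq> 0 \<Longrightarrow> m \<le> 0" "\<And>m. b \<le> m \<Longrightarrow> coeff y m = coeff z m" "b \<le> l"
  shows "coeff (x * y) l = coeff (x * z) l"
proof -
  obtain u where u: "\<And>l. coeff y l \<noteq> 0 \<Longrightarrow> l \<le> u" using coeff_bound by blast
  obtain v where v: "\<And>l. coeff z l \<noteq> 0 \<Longrightarrow> l \<le> v" using coeff_bound by blast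
  define A where "A = {m. l - max u v \<le> m \<and> coeff x m \<noteq> 0}"
  have fin: "finite A" unfolding A_def by (rule finite_coeff)
  have "coeff (x * y) l = (\<Sum>m\<in>A. coeff x m * coeff y (l - m))"
  proof (rule coeff_mult[OF fin])
    fix m assume m: "coeff x m \<noteq> 0" "coeff y (l - m) \<noteq> 0"
    show "m \<in> A" unfolding A_def by (rule mult_mem[OF m u]) auto
  qed
  also have "\<dots> = (\<Sum>m\<in>A. coeff x m * coeff z (l - m))"
    by (rule sum.cong[OF refl]) (use assms in \<open>force simp: A_def\<close>)
  also have "\<dots> = coeff (x * z) l"
  proof (rule coeff_mult[symmetric, OF fin])
    fix m assume m: "coeff x m \<noteq> 0" "coeff z (l - m) \<noteq> 0"
    show "m \<in> A" unfolding A_def by (rule mult_mem[OF m v]) auto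
  qed
  finally show ?thesis .
qed

lemma coeff_power_bound:
  assumes "\<And>m. coeff y m \<noteq> 0 \<Longrightarrow> m \<le> - d" "coeff (y ^ n) l \<noteq> 0"
  shows "l \<le> - (real n * d)"
  using assms(2)
proof (induction n arbitrary: l)
  case 0
  then show ?case by (auto simp: one_gpuiseux.rep_eq split: if_splits)
next
  case (Suc n)
  then obtain m where m: "coeff y m \<noteq> 0" "coeff (y ^ n) (l - m) \<noteq> 0"
    unfolding power_Suc by (elim coeff_multE)
  show ?case using assms(1)[OF m(1)] Suc.IH[OF m(2)] by (simp add: algebra_simps)
qed

lemma coeff_sum: "coeff (sum F A) l = (\<Sum>i\<in>A. coeff (F i) l)"
  by (induction A rule: infinite_finite_induct)
    (auto simp: zero_gpuiseux.rep_eq plus_gpuiseux.rep_eq)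

lemma geometric_inverse:
  assumes "\<And>m. coeff y m \<noteq> 0 \<Longrightarrow> m \<le> - d" "d > 0"
  shows "\<exists>z. (1 - y) * z = 1"
proof -
  define N where "N = (\<lambda>b. nat \<lceil>- b / d\<rceil>)"
  have N: "coeff (y ^ n) l = 0" if "b \<le> l" "N b < n" for n b l
  proof (rule ccontr)
    assume "coeff (y ^ n) l \<noteq> 0"
    then have "l \<le> - (real n * d)" using coeff_power_bound[of y d n l] assms(1) by blast
    moreover have "- b / d < real n" using that(2) unfolding N_def by linarith
    then have "- b < real n * d" using assms(2) pos_divide_less_eq[of d "- b"] by blast
    ultimately show False using that(1) by linarith
  qed
  define Z where "Z = (\<lambda>l. coeff (\<Sum>n\<le>N l. y ^ n) l)"
  have ZN: "Z l = coeff (\<Sum>n\<le>N b. y ^ n) l" if "b \<le> l" for b l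
  proof -
    have "N l \<le> N b" unfolding N_def using that assms(2)
      by (intro nat_mono ceiling_mono) (simp add: divide_right_mono)
    then show ?thesis unfolding Z_def coeff_sum
      by (intro sum.mono_neutral_left) (auto intro: N[of l])
  qed
  have fin: "finite {l. b \<le> l \<and> Z l \<noteq> 0}" for b
  proof -
    have "{l. b \<le> l \<and> Z l \<noteq> 0} = {l. b \<le> l \<and> coeff (\<Sum>n\<le>N b. y ^ n) l \<noteq> 0}"
      using ZN by auto
    then show ?thesis using finite_coeff by simp
  qed
  define z where "z = Abs_gpuiseux Z"
  have z: "coeff z = Z" unfolding z_def using fin by (simp add: Abs_gpuiseux_inverse)
  have "(1 - y) * z = 1"
  proof (rule gpuiseux_eqI)
    fix l
    have "coeff ((1 - y) * z) l = coeff ((1 - y) * (\<Sum>n\<le>N l. y ^ n)) l"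
    proof (rule coeff_mult_cong_above[of _ l])
      fix m assume "coeff (1 - y) m \<noteq> 0"
      then show "m \<le> 0" using assms(1)[of m] assms(2)
        by (auto simp: minus_gpuiseux.rep_eq one_gpuiseux.rep_eq split: if_splits)
    qed (use ZN z in auto)
    also have "(1 - y) * (\<Sum>n\<le>N l. y ^ n) = 1 - y ^ Suc (N l)"
      using one_diff_power_eq[of y "Suc (N l)"] by (simp add: lessThan_Suc_atMost)
    also have "coeff \<dots> l = coeff 1 l" using N[of l l "Suc (N l)"]
      by (simp add: minus_gpuiseux.rep_eq)
    finally show "coeff ((1 - y) * z) l = coeff 1 l" .
  qed
  then show ?thesis by blast
qed

lemma gpuiseux_inverse_exists:
  assumes "x \<noteq> 0"
  shows "\<exists>z :: gpuiseux. z * x = 1"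
proof -
  define q where "q = monomial (1 / lc x) (- lead_exp x)"
  define y where "y = 1 - q * x"
  have cy: "coeff y l = (if l = 0 then 1 else 0) - coeff x (l + lead_exp x) / lc x" for l
    by (simp add: y_def q_def minus_gpuiseux.rep_eq one_gpuiseux.rep_eq coeff_monomial_mult)
  have neg: "l < 0" if "coeff y l \<noteq> 0" for l
  proof (rule ccontr)
    assume "\<not> l < 0"
    then have "coeff y l = 0" using cy[of l] lead_exp_props[OF assms] lc_eq_0_iff[of x] assms
      by (cases "l = 0") (auto simp: lc_def)
    then show False using that by simp
  qed
  obtain d where d: "d > 0" "\<And>m. coeff y m \<noteq> 0 \<Longrightarrow> m \<le> - d"
  proof (cases "y = 0")
    case True
    then show ?thesis using that[of 1] by (simp add: zero_gpuiseux.rep_eq)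
  next
    case False
    then show ?thesis
      using that[of "- lead_exp y"] neg lead_exp_props[OF False] by (auto simp: not_less[symmetric])
  qed
  then obtain w where "(1 - y) * w = 1" using geometric_inverse by blast
  then have "(w * q) * x = 1" by (simp add: y_def mult_ac)
  then show ?thesis by blast
qed

instantiation gpuiseux :: field
begin

definition inverse_gpuiseux :: "gpuiseux \<Rightarrow> gpuiseux" where
  "inverse_gpuiseux x = (if x = 0 then 0 else SOME z. z * x = 1)"

definition divide_gpuiseux :: "gpuiseux \<Rightarrow> gpuiseux \<Rightarrow> gpuiseux" where
  "divide_gpuiseux x y = x * inverse y"

instance
proof
  fix x y :: gpuiseux
  show "inverse x * x = 1" if "x \<noteq> 0"
    using that someI_ex[OF gpuiseux_inverse_exists[OF that]] by (simp add: inverse_gpuiseux_def)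
  show "x div y = x * inverse y" by (rule divide_gpuiseux_def)
  show "inverse (0 :: gpuiseux) = 0" by (simp add: inverse_gpuiseux_def)
qed

end

instantiation gpuiseux :: linordered_field
begin

definition less_eq_gpuiseux :: "gpuiseux \<Rightarrow> gpuiseux \<Rightarrow> bool" where
  "y \<le> x \<longleftrightarrow> 0 \<le> lc (x - y)"

definition less_gpuiseux :: "gpuiseux \<Rightarrow> gpuiseux \<Rightarrow> bool" where
  "y < x \<longleftrightarrow> y \<le> x \<and> y \<noteq> (x :: gpuiseux)"

definition abs_gpuiseux :: "gpuiseux \<Rightarrow> gpuiseux" where
  "\<bar>x\<bar> = (if x < 0 then - x else (x :: gpuiseux))"

definition sgn_gpuiseux :: "gpuiseux \<Rightarrow> gpuiseux" where
  "sgn x = (if x = 0 then 0 else if 0 < x then 1 else - 1 :: gpuiseux)"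

instance
proof
  fix x y z :: gpuiseux
  have lt: "a < b \<longleftrightarrow> 0 < lc (b - a)" for a b :: gpuiseux
    using lc_eq_0_iff[of "b - a"] by (auto simp: less_gpuiseux_def less_eq_gpuiseux_def order_le_less)
  have sw: "lc (a - b) = - lc (b - a)" for a b
    using lc_uminus[of "b - a"] by simp
  show "x < y \<longleftrightarrow> x \<le> y \<and> \<not> y \<le> x"
    using sw[of x y] by (auto simp: lt less_eq_gpuiseux_def)
  show "x \<le> x" by (simp add: less_eq_gpuiseux_def lc_def)
  show "x \<le> z" if "x \<le> y" "y \<le> z"
  proof (cases "x = y \<or> y = z")
    case False
    then have "lc ((y - x) + (z - y)) > 0"
      using that lc_eq_0_iff[of "y - x"] lc_eq_0_iff[of "z - y"]
      by (intro lc_add_pos) (auto simp: less_eq_gpuiseux_def order_le_less)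
    then show ?thesis by (simp add: less_eq_gpuiseux_def)
  qed (use that in auto)
  show "x = y" if "x \<le> y" "y \<le> x"
    using that sw[of x y] lc_eq_0_iff[of "x - y"] by (auto simp: less_eq_gpuiseux_def)
  show "x \<le> y \<or> y \<le> x" using sw[of x y] by (auto simp: less_eq_gpuiseux_def)
  show "z + x \<le> z + y" if "x \<le> y" using that by (simp add: less_eq_gpuiseux_def)
  show "z * x < z * y" if "x < y" "0 < z"
    using that lc_mult[of z "y - x"] by (simp add: lt right_diff_distrib)
  show "\<bar>x\<bar> = (if x < 0 then - x else x)" by (rule abs_gpuiseux_def)
  show "sgn x = (if x = 0 then 0 else if 0 < x then 1 else - 1)" by (rule sgn_gpuiseux_def)
qed

end

text \<open>
  The tropical semifield is the set of extended reals different from \<open>\<infinity>\<close>, with the order and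
  addition of \<^typ>\<open>ereal\<close>.
\<close>

definition val :: "gpuiseux \<Rightarrow> ereal" where
  "val x = (if x = 0 then - \<infinity> else ereal (lead_exp x))"


section \<open>Signed tropical numbers\<close>

datatype signed_trop = TPos real | TNeg real | TZero

fun modulus :: "signed_trop \<Rightarrow> ereal" where
  "modulus (TPos a) = ereal a"
| "modulus (TNeg a) = ereal a"
| "modulus TZero = - \<infinity>"

definition trop_pos :: "signed_trop set" where
  "trop_pos = range TPos"

definition trop_neg :: "signed_trop set" where
  "trop_neg = range TNeg"

definition sval :: "gpuiseux \<Rightarrow> signed_trop" where
  "sval x = (if 0 < x then TPos (lead_exp x) else if x < 0 then TNeg (lead_exp x) else TZero)"

lemma modulus_sval: "modulus (sval x) = val x"
  by (auto simp: sval_def val_def)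


section \<open>Spectrahedra\<close>

definition metzler :: "gpuiseux ^ 'm ^ 'm \<Rightarrow> bool" where
  "metzler A \<longleftrightarrow> (\<forall>i j. i \<noteq> j \<longrightarrow> A $ i $ j \<le> 0)"

definition psd :: "gpuiseux ^ 'm ^ 'm \<Rightarrow> bool" where
  "psd A \<longleftrightarrow> transpose A = A \<and> (\<forall>v. 0 \<le> (\<Sum>i\<in>UNIV. v $ i * (A *v v) $ i))"

definition spectrahedron :: "('n \<Rightarrow> gpuiseux ^ 'm ^ 'm) \<Rightarrow> (gpuiseux ^ 'n) set" where
  "spectrahedron Q = {x. (\<forall>k. 0 \<le> x $ k) \<and> psd (\<chi> i j. \<Sum>k\<in>UNIV. x $ k * Q k $ i $ j)}"

text \<open>
  The supremum of the empty set of extended reals is \<open>- \<infinity>\<close>, and all suprema below are over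
  finite sets, so they are the maxima of the mathematical definition.
\<close>

definition diag_pos :: "('n \<Rightarrow> signed_trop ^ 'm ^ 'm) \<Rightarrow> 'm \<Rightarrow> ereal ^ 'n \<Rightarrow> ereal" where
  "diag_pos Q i x = (SUP k\<in>{k. Q k $ i $ i \<in> trop_pos}. modulus (Q k $ i $ i) + x $ k)"

definition diag_neg :: "('n \<Rightarrow> signed_trop ^ 'm ^ 'm) \<Rightarrow> 'm \<Rightarrow> ereal ^ 'n \<Rightarrow> ereal" where
  "diag_neg Q i x = (SUP k\<in>{k. Q k $ i $ i \<in> trop_neg}. modulus (Q k $ i $ i) + x $ k)"

definition trop_spectrahedron ::
    "('n \<Rightarrow> signed_trop ^ ('m :: {finite, linorder}) ^ ('m :: {finite, linorder})) \<Rightarrow> (ereal ^ 'n) set" where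
  "trop_spectrahedron Q = {x. (\<forall>k. x $ k \<noteq> \<infinity>) \<and>
     (\<forall>i. diag_pos Q i x \<ge> diag_neg Q i x) \<and>
     (\<forall>i j. i < j \<longrightarrow>
        diag_pos Q i x + diag_pos Q j x \<ge> 2 * (SUP k. modulus (Q k $ i $ j) + x $ k))}"


section \<open>Strata and regularity\<close>

definition trop_support :: "ereal ^ 'n \<Rightarrow> 'n set" where
  "trop_support x = {k. x $ k \<noteq> - \<infinity>}"

text \<open>
  \<open>\<real>\<^sup>K\<close> is the space of functions that are \<^const>\<open>undefined\<close> outside \<open>K\<close>, i.e. the carrier of
  \<^term>\<open>powertop_real K\<close>; for finite \<open>K\<close> its topology is the Euclidean one.
\<close>

definition stratum :: "'n set \<Rightarrow> (ereal ^ 'n) set \<Rightarrow> ('n \<Rightarrow> real) set" where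
  "stratum K S = {(\<lambda>k\<in>K. real_of_ereal (x $ k)) | x. x \<in> S \<and> trop_support x = K}"

definition regular_set :: "'n set \<Rightarrow> ('n \<Rightarrow> real) set \<Rightarrow> bool" where
  "regular_set K S \<longleftrightarrow> closedin (powertop_real K) S \<and>
     S = powertop_real K closure_of (powertop_real K interior_of S)"

end

theory Submission
  imports Defs
begin

text \<open>
  The quadratic form of \<open>A = \<Sum>k. X\<^sub>k Q\<^sub>k\<close> is controlled by \<open>2 \<times> 2\<close> minors up to a constant.
  If \<open>A\<close> is positive semidefinite, then \<open>A\<^sub>i\<^sub>i \<ge> 0\<close> and \<open>A\<^sub>i\<^sub>j\<^sup>2 \<le> A\<^sub>i\<^sub>i A\<^sub>j\<^sub>j\<close>; conversely
  \<open>(m A\<^sub>i\<^sub>j)\<^sup>2 \<le> A\<^sub>i\<^sub>i A\<^sub>j\<^sub>j\<close> for all \<open>i \<noteq> j\<close> suffices.  The Metzler condition makes all terms of an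
  off-diagonal entry nonpositive, so that they cannot cancel, and taking valuations in the necessary
  minors gives exactly the tropical inequalities
  (\<open>val_spectrahedron_in_trop_spectrahedron\<close>).

  The converse inclusion has to beat the constant between the two minor conditions.  Where a tropical
  inequality is strict at \<open>x\<close>, the valuations alone do so.  Where it is an equality, leading
  coefficients must be chosen well.  Let \<open>K\<close> be the support of \<open>x\<close>.  By regularity there is a point
  \<open>y\<close> in the interior of the stratum of \<open>K\<close>, as close to \<open>x\<close> as needed.  Interior points satisfy all
  tropical inequalities strictly (\<open>dominant_strict_diag\<close>, \<open>dominant_strict_offdiag\<close>; this is where
  genericity enters), and for \<open>y\<close> close to \<open>x\<close> a term attaining a diagonal maximum at \<open>y\<close> attains
  it at \<open>x\<close> too (\<open>dominant_nearby\<close>).  The lift is \<open>X\<^sub>k = s powr (y\<^sub>k - x\<^sub>k) t\<close> to the power \<open>x\<^sub>k\<close>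
  for a large real \<open>s\<close>: it has valuation \<open>x\<close>, and in every tie at \<open>x\<close> the strict inequality at \<open>y\<close>
  says that the leading coefficient of the larger side has the larger power of \<open>s\<close> (\<open>ex_lift\<close>).
\<close>

section \<open>Valuation and order on Puiseux series\<close>

lemma val_le_ereal_iff: "val x \<le> ereal a \<longleftrightarrow> (\<forall>l>a. coeff x l = 0)"
proof (cases "x = 0")
  case True
  then show ?thesis by (simp add: val_def zero_gpuiseux.rep_eq)
next
  case False
  show ?thesis
    using lead_exp_props[OF False] False by (auto simp: val_def not_less[symmetric])
qed

lemma val_le_minus_infinity_iff: "val x \<le> - \<infinity> \<longleftrightarrow> x = 0"
  by (simp add: val_def)

lemma val_zero [simp]: "val 0 = - \<infinity>"
  by (simp add: val_def)

lemma val_neq_infinity [simp]: "val x \<noteq> \<infinity>"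
  by (simp add: val_def)

lemma lc_zero [simp]: "lc 0 = 0"
  by (simp add: lc_def)

lemma val_uminus [simp]: "val (- x) = val x"
  by (simp add: val_def lead_exp_def uminus_gpuiseux.rep_eq)

lemma val_sum_le:
  assumes "\<And>k. k \<in> A \<Longrightarrow> val (f k) \<le> z"
  shows "val (sum f A) \<le> z"
proof (cases z)
  case (real r)
  then show ?thesis using assms by (simp add: val_le_ereal_iff coeff_sum)
next
  case MInf
  then have "f k = 0" if "k \<in> A" for k
    using assms[OF that] val_le_minus_infinity_iff by metis
  then show ?thesis by (simp add: sum.neutral)
qed simp

lemma lead_exp_mult:
  assumes "x \<noteq> 0" "y \<noteq> 0"
  shows "lead_exp (x * y) = lead_exp x + lead_exp y"
  by (rule lead_exp_eq) (use coeff_mult_lead[OF assms] lc_eq_0_iff assms in auto)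

lemma val_mult: "val (x * y) = val x + val y"
  by (simp add: val_def lead_exp_mult)

lemma gpuiseux_less_iff: "x < y \<longleftrightarrow> 0 < lc (y - x)" for x y :: gpuiseux
  using lc_eq_0_iff[of "y - x"] by (auto simp: less_gpuiseux_def less_eq_gpuiseux_def order_le_less)

lemma gpuiseux_pos_iff: "0 < x \<longleftrightarrow> 0 < lc x"
  by (simp add: gpuiseux_less_iff)

text \<open>A series is positive when its leading coefficient is, so the order between two positive
  series is settled by the exponents first and by the leading coefficients second.\<close>

lemma less_if_lead_less:
  assumes "0 < v" "u \<noteq> 0"
    and "lead_exp u < lead_exp v \<or> (lead_exp u = lead_exp v \<and> lc u < lc v)"
  shows "u < v"
proof -
  have v: "v \<noteq> 0" "0 < coeff v (lead_exp v)"
    using assms(1) by (auto simp: gpuiseux_pos_iff lc_def split: if_splits)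
  have pos: "0 < coeff (v - u) (lead_exp v)"
    using assms(3) v assms(2) lead_exp_props(2)[OF assms(2)]
    by (auto simp: minus_gpuiseux.rep_eq lc_def)
  have "lc (v - u) = coeff (v - u) (lead_exp v)"
    by (rule lc_eqI)
      (use pos assms(3) lead_exp_props(2)[OF v(1)] lead_exp_props(2)[OF assms(2)]
        in \<open>auto simp: minus_gpuiseux.rep_eq\<close>)
  then show ?thesis using pos by (simp add: gpuiseux_less_iff)
qed

lemma val_mono:
  assumes "0 \<le> u" "u \<le> v"
  shows "val u \<le> val v"
proof (cases "u = 0")
  case False
  then have u: "0 < u" using assms(1) by (simp only: less_le) simp
  have v: "0 < v" using u assms(2) by (rule less_le_trans)
  have "lead_exp u \<le> lead_exp v"
    using less_if_lead_less[OF u, of v] v assms(2) by (metis leD leI less_irrefl)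
  then show ?thesis using False v by (simp add: val_def)
qed simp

lemma monomial_mult: "monomial c e * monomial d f = monomial (c * d) (e + f)"
  by (rule gpuiseux_eqI) (auto simp: coeff_monomial_mult monomial.rep_eq)

lemma lead_monomial:
  assumes "c \<noteq> 0"
  shows "lead_exp (monomial c e) = e" "lc (monomial c e) = c"
    "monomial c e \<noteq> 0" "val (monomial c e) = ereal e"
proof -
  show nz: "monomial c e \<noteq> 0"
    using assms by (metis monomial.rep_eq zero_gpuiseux.rep_eq)
  show l: "lead_exp (monomial c e) = e"
    by (rule lead_exp_eq) (use assms in \<open>auto simp: monomial.rep_eq\<close>)
  show "lc (monomial c e) = c" using nz by (simp add: lc_def l monomial.rep_eq)
  show "val (monomial c e) = ereal e" using nz l by (simp add: val_def)
qed

lemma monomial_pos: "0 < c \<Longrightarrow> 0 < monomial c e"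
  by (simp add: gpuiseux_pos_iff lead_monomial)

lemma of_nat_gpuiseux: "of_nat n = monomial (real n) 0"
  by (rule gpuiseux_eqI, induction n)
    (auto simp: monomial.rep_eq zero_gpuiseux.rep_eq one_gpuiseux.rep_eq plus_gpuiseux.rep_eq)

text \<open>Strictly larger exponents of \<open>t\<close> absorb the constant \<open>n\<close> by themselves.  If they are tied, the
  second inequality reduces to \<open>\<alpha> < \<beta>\<close>, and a large \<open>s\<close> absorbs \<open>n\<close> and the leading coefficients
  of \<open>a\<close> and \<open>b\<close>.\<close>

lemma eventually_monomial_dominates:
  assumes "0 < a" "0 < b" "0 < n"
    and le: "e + lead_exp a \<le> f + lead_exp b"
    and less: "(e + \<alpha>) + lead_exp a < (f + \<beta>) + lead_exp b"
  shows "\<forall>\<^sub>F s in at_top. of_nat n * (monomial (s powr \<alpha>) e * a) \<le> monomial (s powr \<beta>) f * b"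
proof -
  have a: "a \<noteq> 0" "0 < lc a" and b: "b \<noteq> 0" "0 < lc b"
    using assms(1,2) by (auto simp: gpuiseux_pos_iff)
  have c: "\<forall>\<^sub>F s in at_top. real n * (s powr \<alpha> * lc a) < s powr \<beta> * lc b" if "\<alpha> < \<beta>"
  proof -
    define C where "C = 1 + \<bar>real n * lc a / lc b\<bar>"
    have "real n * lc a / lc b < s powr (\<beta> - \<alpha>)" if "C powr (1 / (\<beta> - \<alpha>)) < s" for s
    proof -
      have "(C powr (1 / (\<beta> - \<alpha>))) powr (\<beta> - \<alpha>) < s powr (\<beta> - \<alpha>)"
        using \<open>\<alpha> < \<beta>\<close> that by (intro powr_less_mono2) auto
      then have "C < s powr (\<beta> - \<alpha>)"
        using \<open>\<alpha> < \<beta>\<close> by (simp add: powr_powr C_def)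
      then show ?thesis unfolding C_def by linarith
    qed
    then have "\<forall>\<^sub>F s in at_top. real n * lc a / lc b < s powr (\<beta> - \<alpha>)"
      unfolding eventually_at_top_dense by blast
    then show ?thesis
      using eventually_gt_at_top[of "0 :: real"]
    proof eventually_elim
      case (elim s)
      then have "real n * lc a < s powr (\<beta> - \<alpha>) * lc b" using b(2) by (simp add: field_simps)
      then have "s powr \<alpha> * (real n * lc a) < s powr \<alpha> * (s powr (\<beta> - \<alpha>) * lc b)"
        using elim by simp
      also have "\<dots> = s powr \<beta> * lc b" by (simp add: mult.assoc[symmetric] powr_add[symmetric])
      finally show ?case by (simp add: mult_ac)
    qed
  qed
  have key: "of_nat n * (monomial (s powr \<alpha>) e * a) \<le> monomial (s powr \<beta>) f * b"
    if "0 < s" "e + lead_exp a < f + lead_exp b \<or>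
      e + lead_exp a = f + lead_exp b \<and> real n * (s powr \<alpha> * lc a) < s powr \<beta> * lc b" for s
  proof (rule less_imp_le, rule less_if_lead_less)
    have s: "0 < s powr \<alpha>" "0 < s powr \<beta>" using that(1) by auto
    show "0 < monomial (s powr \<beta>) f * b" using s assms(2) by (simp add: monomial_pos)
    show "of_nat n * (monomial (s powr \<alpha>) e * a) \<noteq> 0"
      using s a assms(3) by (simp add: lead_monomial)
    show "lead_exp (of_nat n * (monomial (s powr \<alpha>) e * a)) < lead_exp (monomial (s powr \<beta>) f * b) \<or>
      lead_exp (of_nat n * (monomial (s powr \<alpha>) e * a)) = lead_exp (monomial (s powr \<beta>) f * b) \<and>
      lc (of_nat n * (monomial (s powr \<alpha>) e * a)) < lc (monomial (s powr \<beta>) f * b)"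
      using that(2) s a b assms(3)
      by (simp add: lead_exp_mult lc_mult lead_monomial of_nat_gpuiseux)
  qed
  show ?thesis
  proof (cases "e + lead_exp a < f + lead_exp b")
    case True
    then show ?thesis using key by (intro eventually_mono[OF eventually_gt_at_top[of 0]]) blast
  next
    case False
    then have "e + lead_exp a = f + lead_exp b" "\<alpha> < \<beta>" using le less by linarith+
    then show ?thesis using key
      by (intro eventually_elim2[OF c eventually_gt_at_top[of 0]]) blast+
  qed
qed


section \<open>Positive semidefiniteness and two-by-two minors\<close>

lemma psd_diag_nonneg:
  fixes A :: "gpuiseux ^ 'm ^ ('m :: finite)"
  assumes "psd A"
  shows "0 \<le> A $ i $ i"
proof -
  define v where "v = (\<chi> k. if k = i then 1 else (0::gpuiseux))"
  have "(A *v v) $ k = A $ k $ i" for k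
    by (simp add: matrix_vector_mult_def v_def if_distrib sum.delta' cong: if_cong)
  then have "(\<Sum>k\<in>UNIV. v $ k * (A *v v) $ k) = (\<Sum>k\<in>UNIV. if k = i then A $ k $ i else 0)"
    by (intro sum.cong) (auto simp: v_def)
  then have "(\<Sum>k\<in>UNIV. v $ k * (A *v v) $ k) = A $ i $ i"
    by simp
  moreover have "0 \<le> (\<Sum>k\<in>UNIV. v $ k * (A *v v) $ k)"
    using assms unfolding psd_def by blast
  ultimately show ?thesis by simp
qed

lemma psd_minor:
  fixes A :: "gpuiseux ^ 'm ^ ('m :: finite)"
  assumes "psd A" "i \<noteq> j"
  shows "A $ i $ j * A $ i $ j \<le> A $ i $ i * A $ j $ j"
proof -
  have sym: "A $ j $ i = A $ i $ j"
    using assms(1) unfolding psd_def by (auto simp: transpose_def vec_eq_iff)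
  \<comment> \<open>the quadratic form on the vectors supported on two coordinates\<close>
  have quad: "0 \<le> A $ i $ i * (a * a) + 2 * A $ i $ j * (a * b) + A $ j $ j * (b * b)" for a b
  proof -
    define v where "v = (\<chi> k. if k = i then a else if k = j then b else (0::gpuiseux))"
    have inner: "(A *v v) $ k = A $ k $ i * a + A $ k $ j * b" for k
    proof -
      have "(A *v v) $ k = (\<Sum>l\<in>{i, j}. A $ k $ l * v $ l)"
        unfolding matrix_vector_mult_def vec_lambda_beta
        by (rule sum.mono_neutral_right) (auto simp: v_def)
      then show ?thesis using assms(2) by (simp add: v_def)
    qed
    have "(\<Sum>k\<in>UNIV. v $ k * (A *v v) $ k) = (\<Sum>k\<in>{i, j}. v $ k * (A *v v) $ k)"
      by (rule sum.mono_neutral_right) (auto simp: v_def)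
    also have "\<dots> = A $ i $ i * (a * a) + 2 * A $ i $ j * (a * b) + A $ j $ j * (b * b)"
      unfolding inner using assms(2) sym by (simp add: v_def algebra_simps)
    finally have "(\<Sum>k\<in>UNIV. v $ k * (A *v v) $ k)
      = A $ i $ i * (a * a) + 2 * A $ i $ j * (a * b) + A $ j $ j * (b * b)" .
    moreover have "0 \<le> (\<Sum>k\<in>UNIV. v $ k * (A *v v) $ k)"
      using assms(1) unfolding psd_def by blast
    ultimately show ?thesis by simp
  qed
  let ?p = "A $ i $ i" and ?q = "A $ j $ j" and ?r = "A $ i $ j"
  have p: "0 \<le> ?p" and q: "0 \<le> ?q" using psd_diag_nonneg[OF assms(1)] by auto
  consider "0 < ?p" | "0 < ?q" | "?p = 0" "?q = 0" using p q by fastforce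
  then show ?thesis
  proof cases
    case 1
    have "0 \<le> ?p * (?p * ?q - ?r * ?r)" using quad[of "- ?r" ?p] by (simp add: algebra_simps)
    then show ?thesis using 1 by (simp add: zero_le_mult_iff)
  next
    case 2
    have "0 \<le> ?q * (?p * ?q - ?r * ?r)" using quad[of ?q "- ?r"] by (simp add: algebra_simps)
    then show ?thesis using 2 by (simp add: zero_le_mult_iff)
  next
    case 3
    then show ?thesis using quad[of 1 "- ?r"]
      by (simp add: algebra_simps)
  qed
qed

text \<open>The factor \<open>m\<^sup>2\<close> allows the off-diagonal terms to be absorbed pair by pair: the inequality of
  the arithmetic and the geometric mean gives \<open>2 m \<bar>A\<^sub>i\<^sub>j v\<^sub>i v\<^sub>j\<bar> \<le> A\<^sub>i\<^sub>i v\<^sub>i\<^sup>2 + A\<^sub>j\<^sub>j v\<^sub>j\<^sup>2\<close>, and summing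
  over all pairs yields \<open>2 m\<close> times the diagonal part on the right.\<close>

lemma psd_if_minors_dominate:
  fixes A :: "gpuiseux ^ 'm ^ ('m :: finite)"
  assumes sym: "transpose A = A" and diag: "\<And>i. 0 \<le> A $ i $ i"
    and minor: "\<And>i j. i \<noteq> j \<Longrightarrow> (of_nat CARD('m) * A $ i $ j)\<^sup>2 \<le> A $ i $ i * A $ j $ j"
  shows "psd A"
  unfolding psd_def
proof (intro conjI sym allI)
  fix v :: "gpuiseux ^ 'm"
  define d where "d = (\<lambda>i. A $ i $ i * (v $ i)\<^sup>2)"
  define N where "N = (\<lambda>i j. if i = j then 0 else A $ i $ j * (v $ i * v $ j))"
  let ?m = "of_nat CARD('m) :: gpuiseux"
  have d0: "0 \<le> d i" for i unfolding d_def using diag by simp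
  have NN: "- (2 * ?m * N i j) \<le> d i + d j" for i j
  proof (cases "i = j")
    case True
    then show ?thesis using d0[of j] by (simp add: N_def)
  next
    case False
    have "(2 * ?m * N i j)\<^sup>2 = 4 * ((?m * A $ i $ j)\<^sup>2 * ((v $ i)\<^sup>2 * (v $ j)\<^sup>2))"
      using False by (simp add: N_def power_mult_distrib mult_ac)
    also have "\<dots> \<le> 4 * ((A $ i $ i * A $ j $ j) * ((v $ i)\<^sup>2 * (v $ j)\<^sup>2))"
      using minor[OF False] by (intro mult_left_mono mult_right_mono) auto
    also have "\<dots> = 4 * (d i * d j)" by (simp add: d_def mult_ac)
    also have "\<dots> \<le> 4 * (d i * d j) + (d i - d j)\<^sup>2" by simp
    also have "\<dots> = (d i + d j)\<^sup>2" by (simp add: power2_eq_square algebra_simps)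
    finally have "(- (2 * ?m * N i j))\<^sup>2 \<le> (d i + d j)\<^sup>2" by simp
    then show ?thesis by (rule power2_le_imp_le) (simp add: d0)
  qed
  have "(\<Sum>i\<in>UNIV. \<Sum>j\<in>UNIV. - (2 * ?m * N i j)) \<le> (\<Sum>i\<in>UNIV. \<Sum>j\<in>UNIV. d i + d j)"
    by (intro sum_mono NN)
  also have "\<dots> = 2 * ?m * (\<Sum>i\<in>UNIV. d i)"
    by (simp add: sum.distrib sum_distrib_left[symmetric])
  also have "(\<Sum>i\<in>UNIV. \<Sum>j\<in>UNIV. - (2 * ?m * N i j))
      = - (2 * ?m * (\<Sum>i\<in>UNIV. \<Sum>j\<in>UNIV. N i j))"
    by (simp only: sum_negf sum_distrib_left)
  finally have "2 * ?m * 0 \<le> 2 * ?m * ((\<Sum>i\<in>UNIV. d i) + (\<Sum>i\<in>UNIV. \<Sum>j\<in>UNIV. N i j))"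
    unfolding distrib_left mult_zero_right by (metis add.commute add.right_inverse add_le_cancel_left)
  moreover have "0 < 2 * ?m" by simp
  ultimately have "0 \<le> (\<Sum>i\<in>UNIV. d i) + (\<Sum>i\<in>UNIV. \<Sum>j\<in>UNIV. N i j)"
    by (simp only: mult_le_cancel_left_pos)
  also have "\<dots> = (\<Sum>i\<in>UNIV. \<Sum>j\<in>UNIV. A $ i $ j * (v $ i * v $ j))"
  proof -
    have "(\<Sum>j\<in>UNIV. A $ i $ j * (v $ i * v $ j)) = d i + (\<Sum>j\<in>UNIV. N i j)" for i
    proof -
      have "(\<Sum>j\<in>UNIV. A $ i $ j * (v $ i * v $ j))
          = (\<Sum>j\<in>UNIV. (if i = j then d i else 0) + N i j)"
        by (rule sum.cong) (auto simp: d_def N_def power2_eq_square)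
      then show ?thesis by (simp add: sum.distrib)
    qed
    then show ?thesis by (simp add: sum.distrib)
  qed
  also have "\<dots> = (\<Sum>i\<in>UNIV. v $ i * (A *v v) $ i)"
    by (simp add: matrix_vector_mult_def sum_distrib_left mult_ac)
  finally show "0 \<le> (\<Sum>i\<in>UNIV. v $ i * (A *v v) $ i)" .
qed


section \<open>Valuations of points of the spectrahedron\<close>

lemma sum_nonpos_le_member:
  fixes f :: "'a \<Rightarrow> 'b :: ordered_ab_group_add"
  assumes "finite A" "l \<in> A" "\<And>k. k \<in> A \<Longrightarrow> f k \<le> 0"
  shows "sum f A \<le> f l"
proof -
  have "sum f (A - {l}) \<le> 0" using assms(3) by (intro sum_nonpos) auto
  then show ?thesis using sum.remove[OF assms(1,2), of f] by simp
qed

text \<open>It is enough to compare with the positive parts of the diagonal: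
  \<open>A\<^sub>i\<^sub>i\<close> is at most the sum \<open>P i\<close> of its positive terms, whose valuation is at most
  \<^const>\<open>diag_pos\<close>.  Terms of one sign do not cancel, so each
  nonpositive term of \<open>A\<^sub>i\<^sub>i\<close> is at most \<open>P i\<close> in modulus, and the square of each term of \<open>A\<^sub>i\<^sub>j\<close> is
  at most \<open>P i P j\<close>.\<close>

lemma val_spectrahedron_in_trop_spectrahedron:
  fixes Q :: "'n :: finite \<Rightarrow> gpuiseux ^ ('m :: {finite, linorder}) ^ ('m :: {finite, linorder})"
  assumes metz: "\<And>k. metzler (Q k)" and X: "X \<in> spectrahedron Q"
  shows "(\<chi> k. val (X $ k)) \<in> trop_spectrahedron (\<lambda>k. \<chi> i j. sval (Q k $ i $ j))"
    (is "?x \<in> trop_spectrahedron ?T")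
proof -
  define A where "A = (\<chi> i j. \<Sum>k\<in>UNIV. X $ k * Q k $ i $ j)"
  have X0: "0 \<le> X $ k" for k
    using X by (simp add: spectrahedron_def)
  have psd: "psd A"
    using X by (simp add: spectrahedron_def A_def)
  define P where "P = (\<lambda>i. \<Sum>k | 0 < Q k $ i $ i. X $ k * Q k $ i $ i)"
  have P0: "0 \<le> P i" for i
    unfolding P_def using X0 by (intro sum_nonneg mult_nonneg_nonneg) auto
  have split: "A $ i $ i = P i + (\<Sum>k | \<not> 0 < Q k $ i $ i. X $ k * Q k $ i $ i)" for i
  proof -
    have "(\<Sum>k\<in>UNIV. X $ k * Q k $ i $ i) = (\<Sum>k\<in>UNIV \<inter> {k. 0 < Q k $ i $ i}. X $ k * Q k $ i $ i)
        + (\<Sum>k\<in>UNIV \<inter> - {k. 0 < Q k $ i $ i}. X $ k * Q k $ i $ i)"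
      by (rule sum.Int_Diff[of UNIV _ "{k. 0 < Q k $ i $ i}", unfolded Diff_eq]) simp
    then show ?thesis by (simp add: A_def P_def Collect_neg_eq)
  qed
  have nonpos: "X $ k * Q k $ i $ i \<le> 0" if "\<not> 0 < Q k $ i $ i" for k i
    using that X0 by (intro mult_nonneg_nonpos) auto
  have A_le_P: "A $ i $ i \<le> P i" for i
  proof -
    have "(\<Sum>k | \<not> 0 < Q k $ i $ i. X $ k * Q k $ i $ i) \<le> 0"
      by (rule sum_nonpos) (use nonpos in blast)
    then show ?thesis unfolding split by simp
  qed
  have diag0: "0 \<le> A $ i $ i" for i
    by (rule psd_diag_nonneg[OF psd])
  have pos_iff: "?T k $ i $ i \<in> trop_pos \<longleftrightarrow> 0 < Q k $ i $ i" for k i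
    by (auto simp: sval_def trop_pos_def)
  have neg_iff: "?T k $ i $ i \<in> trop_neg \<longleftrightarrow> Q k $ i $ i < 0" for k i
    by (auto simp: sval_def trop_neg_def)
  have entry: "modulus (?T k $ i $ j) + ?x $ k = val (X $ k * Q k $ i $ j)" for k i j
    by (simp add: modulus_sval val_mult add.commute)
  have P_le: "val (P i) \<le> diag_pos ?T i ?x" for i
    unfolding P_def
  proof (rule val_sum_le)
    fix k assume "k \<in> {k. 0 < Q k $ i $ i}"
    then show "val (X $ k * Q k $ i $ i) \<le> diag_pos ?T i ?x"
      unfolding diag_pos_def entry pos_iff by (intro SUP_upper) simp
  qed
  have diag: "diag_neg ?T i ?x \<le> diag_pos ?T i ?x" for i
    unfolding diag_neg_def entry neg_iff
  proof (rule SUP_least)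
    fix l assume "l \<in> {k. Q k $ i $ i < 0}"
    then have l: "\<not> 0 < Q l $ i $ i" by auto
    have "(\<Sum>k | \<not> 0 < Q k $ i $ i. X $ k * Q k $ i $ i) \<le> X $ l * Q l $ i $ i"
      using nonpos l by (intro sum_nonpos_le_member) auto
    then have "- (X $ l * Q l $ i $ i) \<le> P i"
      using diag0[of i] unfolding split by (simp add: le_minus_iff) 
    then have "val (- (X $ l * Q l $ i $ i)) \<le> val (P i)"
      using nonpos[OF l] by (intro val_mono) simp_all
    then show "val (X $ l * Q l $ i $ i) \<le> diag_pos ?T i ?x"
      using P_le[of i] by simp
  qed
  have off: "2 * (SUP k. modulus (?T k $ i $ j) + ?x $ k) \<le> diag_pos ?T i ?x + diag_pos ?T j ?x"
    if ij: "i \<noteq> j" for i j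
  proof -
    have "Max (range (\<lambda>k. val (X $ k * Q k $ i $ j))) \<in> range (\<lambda>k. val (X $ k * Q k $ i $ j))"
      by (intro Max_in) auto
    then obtain l where "Max (range (\<lambda>k. val (X $ k * Q k $ i $ j))) = val (X $ l * Q l $ i $ j)"
      by blast
    then have l: "(SUP k. val (X $ k * Q k $ i $ j)) = val (X $ l * Q l $ i $ j)"
      by (simp add: cSup_eq_Max)
    have np: "X $ k * Q k $ i $ j \<le> 0" for k
      using metz[of k] ij X0[of k] by (intro mult_nonneg_nonpos) (auto simp: metzler_def)
    have "(\<Sum>k\<in>UNIV. X $ k * Q k $ i $ j) \<le> X $ l * Q l $ i $ j"
      using np by (intro sum_nonpos_le_member) auto
    then have le: "A $ i $ j \<le> X $ l * Q l $ i $ j" by (simp add: A_def)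
    have "(X $ l * Q l $ i $ j) * (X $ l * Q l $ i $ j) \<le> A $ i $ j * A $ i $ j"
      using mult_mono[of "- (X $ l * Q l $ i $ j)" "- A $ i $ j" "- (X $ l * Q l $ i $ j)" "- A $ i $ j"]
        le np[of l] by (simp del: mult_le_0_iff)
    also have "\<dots> \<le> A $ i $ i * A $ j $ j" using psd_minor[OF psd ij] .
    also have "\<dots> \<le> P i * P j" using A_le_P diag0 P0 by (intro mult_mono) auto
    finally have "val ((X $ l * Q l $ i $ j) * (X $ l * Q l $ i $ j)) \<le> val (P i * P j)"
      by (intro val_mono) auto
    also have "\<dots> \<le> diag_pos ?T i ?x + diag_pos ?T j ?x"
      unfolding val_mult by (intro add_mono P_le)
    finally show ?thesis
      unfolding entry l val_mult[of "X $ l * Q l $ i $ j" "X $ l * Q l $ i $ j"]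
      by (cases "val (X $ l * Q l $ i $ j)") auto
  qed
  show ?thesis unfolding trop_spectrahedron_def using diag off by auto
qed


section \<open>The tropical inequalities in a stratum\<close>

text \<open>On points with support \<open>K\<close> the tropical inequalities involve finite numbers only.  Replacing
  each maximum by the existence of a witness turns them into inequalities between real numbers.\<close>

definition satisfies_trop_ineqs ::
    "('n \<Rightarrow> gpuiseux ^ 'm ^ 'm) \<Rightarrow> 'n set \<Rightarrow> ('n \<Rightarrow> real) \<Rightarrow> bool" where
  "satisfies_trop_ineqs Q K y \<longleftrightarrow>
     (\<forall>i. \<forall>l\<in>K. Q l $ i $ i < 0 \<longrightarrow> (\<exists>p\<in>K. 0 < Q p $ i $ i \<and>
        lead_exp (Q l $ i $ i) + y l \<le> lead_exp (Q p $ i $ i) + y p)) \<and>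
     (\<forall>i j. \<forall>l\<in>K. i \<noteq> j \<longrightarrow> Q l $ i $ j \<noteq> 0 \<longrightarrow>
        (\<exists>p\<in>K. \<exists>q\<in>K. 0 < Q p $ i $ i \<and> 0 < Q q $ j $ j \<and>
           2 * (lead_exp (Q l $ i $ j) + y l)
             \<le> (lead_exp (Q p $ i $ i) + y p) + (lead_exp (Q q $ j $ j) + y q)))"

text \<open>A dominant index attains the maximum that defines \<^const>\<open>diag_pos\<close>.\<close>

definition dominant ::
    "('n \<Rightarrow> gpuiseux ^ 'm ^ 'm) \<Rightarrow> 'n set \<Rightarrow> ('n \<Rightarrow> real) \<Rightarrow> 'm \<Rightarrow> 'n \<Rightarrow> bool" where
  "dominant Q K y i p \<longleftrightarrow> p \<in> K \<and> 0 < Q p $ i $ i \<and>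
     (\<forall>k\<in>K. 0 < Q k $ i $ i \<longrightarrow> lead_exp (Q k $ i $ i) + y k \<le> lead_exp (Q p $ i $ i) + y p)"

definition extend_by_bottom :: "'n set \<Rightarrow> ('n \<Rightarrow> real) \<Rightarrow> ereal ^ 'n" where
  "extend_by_bottom K y = (\<chi> k. if k \<in> K then ereal (y k) else - \<infinity>)"

lemma satisfies_trop_ineqs_diagE:
  assumes "satisfies_trop_ineqs Q K y" "l \<in> K" "Q l $ i $ i < 0"
  obtains p where "p \<in> K" "0 < Q p $ i $ i"
    "lead_exp (Q l $ i $ i) + y l \<le> lead_exp (Q p $ i $ i) + y p"
  using assms(1)[unfolded satisfies_trop_ineqs_def, THEN conjunct1, rule_format, OF assms(2,3)] that
  by (elim bexE conjE)

lemma satisfies_trop_ineqs_offdiagE: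
  assumes "satisfies_trop_ineqs Q K y" "l \<in> K" "i \<noteq> j" "Q l $ i $ j \<noteq> 0"
  obtains p q where "p \<in> K" "0 < Q p $ i $ i" "q \<in> K" "0 < Q q $ j $ j"
    "2 * (lead_exp (Q l $ i $ j) + y l)
      \<le> (lead_exp (Q p $ i $ i) + y p) + (lead_exp (Q q $ j $ j) + y q)"
  using assms(1)[unfolded satisfies_trop_ineqs_def, THEN conjunct2, rule_format, OF assms(2-4)] that
  by (elim bexE conjE)

lemma dominantD:
  assumes "dominant Q K y i p"
  shows "p \<in> K" "0 < Q p $ i $ i"
    "\<lbrakk>k \<in> K; 0 < Q k $ i $ i\<rbrakk> \<Longrightarrow> lead_exp (Q k $ i $ i) + y k \<le> lead_exp (Q p $ i $ i) + y p"
  using assms unfolding dominant_def by blast+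

lemma ex_dominant:
  fixes Q :: "'n :: finite \<Rightarrow> gpuiseux ^ 'm ^ 'm"
  assumes "k \<in> K" "0 < Q k $ i $ i"
  shows "\<exists>p. dominant Q K y i p"
proof -
  let ?B = "{k \<in> K. 0 < Q k $ i $ i}"
  let ?f = "\<lambda>k. lead_exp (Q k $ i $ i) + y k"
  have "Max (?f ` ?B) \<in> ?f ` ?B" using assms by (intro Max_in) auto
  then obtain p where p: "p \<in> ?B" "?f p = Max (?f ` ?B)" by auto
  have "?f k \<le> ?f p" if "k \<in> ?B" for k
    unfolding p(2) using that by (intro Max_ge) auto
  then show ?thesis using p(1) unfolding dominant_def by auto
qed

lemma finite_SUP_ereal_cases:
  fixes f :: "'a \<Rightarrow> ereal"
  assumes "finite A"
  shows "(SUP k\<in>A. f k) = - \<infinity> \<or> (\<exists>k\<in>A. (SUP k\<in>A. f k) = f k)"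
  using assms
proof (induction A rule: finite_induct)
  case empty
  then show ?case by (simp add: bot_ereal_def)
next
  case (insert a A)
  have "(SUP k\<in>insert a A. f k) = max (f a) (SUP k\<in>A. f k)" by (simp add: sup_max)
  then show ?case using insert.IH by (auto simp: max_def)
qed

lemma satisfies_trop_ineqs_if_extend_by_bottom:
  fixes Q :: "'n :: finite \<Rightarrow> gpuiseux ^ ('m :: {finite, linorder}) ^ ('m :: {finite, linorder})"
  assumes sym: "\<And>k. transpose (Q k) = Q k"
    and y: "extend_by_bottom K y \<in> trop_spectrahedron (\<lambda>k. \<chi> i j. sval (Q k $ i $ j))"
      (is "?x \<in> trop_spectrahedron ?T")
  shows "satisfies_trop_ineqs Q K y"
proof -
  have sym': "Q k $ i $ j = Q k $ j $ i" for k i j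
    using sym[of k] by (auto simp: transpose_def vec_eq_iff)
  have pos_iff: "?T k $ i $ i \<in> trop_pos \<longleftrightarrow> 0 < Q k $ i $ i" for k i
    by (auto simp: sval_def trop_pos_def)
  have neg_iff: "?T k $ i $ i \<in> trop_neg \<longleftrightarrow> Q k $ i $ i < 0" for k i
    by (auto simp: sval_def trop_neg_def)
  have entry: "modulus (?T k $ i $ j) + ?x $ k =
    (if k \<in> K \<and> Q k $ i $ j \<noteq> 0 then ereal (lead_exp (Q k $ i $ j) + y k) else - \<infinity>)" for k i j
    by (simp add: modulus_sval val_def extend_by_bottom_def)
  have dp: "diag_pos ?T i ?x = - \<infinity> \<or>
    (\<exists>p\<in>K. 0 < Q p $ i $ i \<and> diag_pos ?T i ?x = ereal (lead_exp (Q p $ i $ i) + y p))" for i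
    using finite_SUP_ereal_cases[of "{k. ?T k $ i $ i \<in> trop_pos}"
        "\<lambda>k. modulus (?T k $ i $ i) + ?x $ k"]
    unfolding diag_pos_def[symmetric]
    unfolding entry pos_iff by (auto split: if_splits)
  have diag: "\<exists>p\<in>K. 0 < Q p $ i $ i \<and> lead_exp (Q l $ i $ i) + y l \<le> lead_exp (Q p $ i $ i) + y p"
    if l: "l \<in> K" "Q l $ i $ i < 0" for i l
  proof -
    have "modulus (?T l $ i $ i) + ?x $ l \<le> diag_neg ?T i ?x"
      unfolding diag_neg_def neg_iff using l by (intro SUP_upper) auto
    also have "\<dots> \<le> diag_pos ?T i ?x" using y by (simp add: trop_spectrahedron_def)
    finally have "ereal (lead_exp (Q l $ i $ i) + y l) \<le> diag_pos ?T i ?x"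
      unfolding entry using l by auto
    then show ?thesis using dp[of i] by auto
  qed
  have off: "\<exists>p\<in>K. \<exists>q\<in>K. 0 < Q p $ i $ i \<and> 0 < Q q $ j $ j \<and>
      2 * (lead_exp (Q l $ i $ j) + y l)
        \<le> (lead_exp (Q p $ i $ i) + y p) + (lead_exp (Q q $ j $ j) + y q)"
    if l: "l \<in> K" "Q l $ i $ j \<noteq> 0" and ij: "i < j" for i j l
  proof -
    have "ereal (lead_exp (Q l $ i $ j) + y l) \<le> (SUP k. modulus (?T k $ i $ j) + ?x $ k)"
      using SUP_upper[of l UNIV "\<lambda>k. modulus (?T k $ i $ j) + ?x $ k"] l unfolding entry by simp
    then have "2 * ereal (lead_exp (Q l $ i $ j) + y l)
        \<le> 2 * (SUP k. modulus (?T k $ i $ j) + ?x $ k)"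
      by (intro ereal_mult_left_mono) auto
    also have "\<dots> \<le> diag_pos ?T i ?x + diag_pos ?T j ?x"
      using y ij by (simp add: trop_spectrahedron_def)
    finally have le: "ereal (2 * (lead_exp (Q l $ i $ j) + y l)) \<le> diag_pos ?T i ?x + diag_pos ?T j ?x"
      by simp
    obtain p where "p \<in> K" "0 < Q p $ i $ i" "diag_pos ?T i ?x = ereal (lead_exp (Q p $ i $ i) + y p)"
      using dp[of i] dp[of j] le by auto
    moreover obtain q where "q \<in> K" "0 < Q q $ j $ j" "diag_pos ?T j ?x = ereal (lead_exp (Q q $ j $ j) + y q)"
      using dp[of i] dp[of j] le by auto
    ultimately show ?thesis using le by auto
  qed
  have off': "\<exists>p\<in>K. \<exists>q\<in>K. 0 < Q p $ i $ i \<and> 0 < Q q $ j $ j \<and>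
      2 * (lead_exp (Q l $ i $ j) + y l)
        \<le> (lead_exp (Q p $ i $ i) + y p) + (lead_exp (Q q $ j $ j) + y q)"
    if l: "l \<in> K" "Q l $ i $ j \<noteq> 0" and ij: "i \<noteq> j" for i j l
  proof (cases "i < j")
    case True
    then show ?thesis using off l by blast
  next
    case False
    then have "j < i" using ij by simp
    from off[OF l(1) _ this] show ?thesis
      using l(2) by (metis sym' add.commute)
  qed
  show ?thesis unfolding satisfies_trop_ineqs_def using diag off' by blast
qed


section \<open>Interior points satisfy the inequalities strictly\<close>

text \<open>Suppose an inequality is tight at \<open>y\<close> and its smaller side comes from index \<open>l\<close>.  Raising the
  single coordinate \<open>y l\<close> by \<open>h\<close> raises that side, so the inequality can persist only if the
  diagonal maxima on the larger side rise as well, that is, if they are attained at the same index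
  \<open>l\<close>.  A diagonal entry of \<open>Q l\<close> cannot be both negative and positive, which settles the diagonal
  inequalities.\<close>

lemma dominant_strict_diag:
  assumes bump: "0 < h" "satisfies_trop_ineqs Q K (y(l := y l + h))"
    and l: "l \<in> K" "Q l $ i $ i < 0" and p: "dominant Q K y i p"
  shows "lead_exp (Q l $ i $ i) + y l < lead_exp (Q p $ i $ i) + y p"
proof -
  obtain p' where p': "p' \<in> K" "0 < Q p' $ i $ i"
    "lead_exp (Q l $ i $ i) + (y l + h) \<le> lead_exp (Q p' $ i $ i) + (y(l := y l + h)) p'"
    by (rule satisfies_trop_ineqs_diagE[OF bump(2) l, unfolded fun_upd_same])
  moreover have "p' \<noteq> l" using p'(2) l(2) by auto
  moreover have "lead_exp (Q p' $ i $ i) + y p' \<le> lead_exp (Q p $ i $ i) + y p"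
    by (rule dominantD(3)[OF p p'(1,2)])
  ultimately show ?thesis using bump(1) by simp
qed

text \<open>Here both maxima would be attained at \<open>l\<close>; then \<open>y l\<close> drops out of the tight inequality, which
  becomes the equation between exponents of \<open>Q l\<close> that genericity excludes.\<close>

lemma dominant_strict_offdiag:
  assumes bump: "0 < h" "satisfies_trop_ineqs Q K (y(l := y l + h))"
    and l: "l \<in> K" "i \<noteq> j" "Q l $ i $ j \<noteq> 0"
    and generic: "0 < Q l $ i $ i \<Longrightarrow> 0 < Q l $ j $ j \<Longrightarrow>
      lead_exp (Q l $ i $ i) + lead_exp (Q l $ j $ j) \<noteq> 2 * lead_exp (Q l $ i $ j)"
    and p: "dominant Q K y i p" and q: "dominant Q K y j q"
  shows "2 * (lead_exp (Q l $ i $ j) + y l)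
    < (lead_exp (Q p $ i $ i) + y p) + (lead_exp (Q q $ j $ j) + y q)"
proof (rule ccontr)
  assume *: "\<not> ?thesis"
  let ?y = "y(l := y l + h)"
  obtain p' q' where pq: "p' \<in> K" "0 < Q p' $ i $ i" "q' \<in> K" "0 < Q q' $ j $ j"
    "2 * (lead_exp (Q l $ i $ j) + (y l + h))
      \<le> (lead_exp (Q p' $ i $ i) + ?y p') + (lead_exp (Q q' $ j $ j) + ?y q')"
    by (rule satisfies_trop_ineqs_offdiagE[OF bump(2) l, unfolded fun_upd_same])
  have max: "lead_exp (Q p' $ i $ i) + y p' \<le> lead_exp (Q p $ i $ i) + y p"
    "lead_exp (Q q' $ j $ j) + y q' \<le> lead_exp (Q q $ j $ j) + y q"
    by (rule dominantD(3)[OF p pq(1,2)], rule dominantD(3)[OF q pq(3,4)])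
  have "p' = l" using * max pq(5) bump(1) by (cases "p' = l"; cases "q' = l") simp_all
  moreover have "q' = l" using * max pq(5) bump(1) by (cases "p' = l"; cases "q' = l") simp_all
  ultimately show False using * max pq(2,4,5) generic by simp
qed

text \<open>The radius \<open>\<delta>\<close> is smaller than half of every positive gap between two diagonal terms at \<open>x\<close>, so
  that moving each coordinate by less than \<open>\<delta>\<close> cannot reverse a strict comparison.\<close>

lemma dominant_nearby:
  fixes Q :: "'n :: finite \<Rightarrow> gpuiseux ^ ('m :: finite) ^ ('m :: finite)"
  obtains \<delta> where "0 < \<delta>"
    "\<And>y i p. \<lbrakk>\<And>k. k \<in> K \<Longrightarrow> \<bar>y k - x k\<bar> < \<delta>; dominant Q K y i p\<rbrakk> \<Longrightarrow> dominant Q K x i p"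
proof -
  define g where "g = (\<lambda>i k k'. (lead_exp (Q k $ i $ i) + x k) - (lead_exp (Q k' $ i $ i) + x k'))"
  have "\<forall>\<^sub>F \<delta> in at_right 0. \<forall>i k k'. 0 < g i k k' \<longrightarrow> \<delta> < g i k k' / 2"
  proof (intro eventually_all_finite)
    fix i k k'
    show "\<forall>\<^sub>F \<delta> in at_right 0. 0 < g i k k' \<longrightarrow> \<delta> < g i k k' / 2"
      using eventually_at_right_real[of 0 "g i k k' / 2"]
      by (cases "0 < g i k k'") (auto elim: eventually_mono)
  qed
  then have "\<forall>\<^sub>F \<delta> in at_right 0. 0 < \<delta> \<and> (\<forall>i k k'. 0 < g i k k' \<longrightarrow> \<delta> < g i k k' / 2)"
    using eventually_at_right_less[of "0::real"] by eventually_elim blast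
  then obtain \<delta> where \<delta>: "0 < \<delta>" "\<And>i k k'. 0 < g i k k' \<Longrightarrow> \<delta> < g i k k' / 2"
    using eventually_happens'[OF trivial_limit_at_right_real] by blast
  show ?thesis
  proof
    show "0 < \<delta>" by fact
    fix y i p assume near: "\<And>k. k \<in> K \<Longrightarrow> \<bar>y k - x k\<bar> < \<delta>" and p: "dominant Q K y i p"
    have "lead_exp (Q k $ i $ i) + x k \<le> lead_exp (Q p $ i $ i) + x p"
      if k: "k \<in> K" "0 < Q k $ i $ i" for k
    proof (rule ccontr)
      assume "\<not> ?thesis"
      then have "\<delta> < g i k p / 2" by (intro \<delta>) (simp add: g_def)
      moreover have "lead_exp (Q k $ i $ i) + y k \<le> lead_exp (Q p $ i $ i) + y p"
        using p k unfolding dominant_def by blast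
      moreover have "\<bar>y p - x p\<bar> < \<delta>" using p unfolding dominant_def by (intro near) blast
      ultimately show False using near[OF k(1)] unfolding g_def abs_less_iff by (simp add: field_simps)
    qed
    then show "dominant Q K x i p" using p unfolding dominant_def by blast
  qed
qed

lemma ex_interior_near:
  fixes S :: "('n :: finite \<Rightarrow> real) set"
  assumes "regular_set K S" "x \<in> S" "0 < \<delta>"
  obtains y where "y \<in> powertop_real K interior_of S" "\<And>k. k \<in> K \<Longrightarrow> \<bar>y k - x k\<bar> < \<delta>"
proof -
  let ?T = "\<Pi>\<^sub>E k\<in>K. ball (x k) \<delta>"
  have cl: "x \<in> powertop_real K closure_of (powertop_real K interior_of S)"
    using assms(1,2) unfolding regular_set_def by blast
  then have "x \<in> ?T" using assms(3)
    by (auto simp: in_closure_of PiE_iff topspace_product_topology)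
  moreover have "openin (powertop_real K) ?T"
    by (subst openin_PiE_gen) auto
  ultimately obtain y where "y \<in> powertop_real K interior_of S" "y \<in> ?T"
    using cl unfolding in_closure_of by blast
  then show ?thesis using that[of y] by (force simp: PiE_iff dist_real_def)
qed

lemma interior_bump:
  fixes S :: "('n :: finite \<Rightarrow> real) set"
  assumes y: "y \<in> powertop_real K interior_of S" and l: "l \<in> K"
  obtains h where "0 < h" "y(l := y l + h) \<in> S"
proof -
  have "\<exists>U. finite {i \<in> K. U i \<noteq> topspace euclideanreal} \<and> (\<forall>i\<in>K. openin euclideanreal (U i)) \<and>
      y \<in> Pi\<^sub>E K U \<and> Pi\<^sub>E K U \<subseteq> powertop_real K interior_of S"
    by (rule bspec[OF iffD1[OF openin_product_topology_alt openin_interior_of] y])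
  then obtain U where U: "\<forall>i\<in>K. openin euclideanreal (U i)" "y \<in> Pi\<^sub>E K U"
    "Pi\<^sub>E K U \<subseteq> powertop_real K interior_of S"
    by (elim exE conjE)
  have "open (U l)" using U(1) l by (simp only: open_openin)
  moreover have "y l \<in> U l" using U(2) l by (rule PiE_mem)
  ultimately obtain e where e: "0 < e" "ball (y l) e \<subseteq> U l"
    by (meson open_contains_ball)
  have "y l + e / 2 \<in> U l" using e(1) by (intro subsetD[OF e(2)]) (simp add: dist_real_def)
  then have "y(l := y l + e / 2) \<in> Pi\<^sub>E K U"
    using PiE_fun_upd[of "y l + e / 2" U l y K] U(2) l by (simp only: insert_absorb)
  then have "y(l := y l + e / 2) \<in> S" by (rule subsetD[OF order_trans[OF U(3) interior_of_subset]])
  then show ?thesis using that[of "e / 2"] e(1) by simp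
qed


section \<open>Lifting\<close>

lemma abs_sum_le_card_mult:
  fixes f :: "'n :: finite \<Rightarrow> 'a :: linordered_idom"
  obtains l where "\<bar>\<Sum>k\<in>UNIV. f k\<bar> \<le> of_nat CARD('n) * \<bar>f l\<bar>"
proof -
  have "Max (range (\<lambda>k. \<bar>f k\<bar>)) \<in> range (\<lambda>k. \<bar>f k\<bar>)" by (intro Max_in) auto
  then obtain l where l: "Max (range (\<lambda>k. \<bar>f k\<bar>)) = \<bar>f l\<bar>" by blast
  have "\<bar>f k\<bar> \<le> \<bar>f l\<bar>" for k unfolding l[symmetric] by (intro Max_ge) auto
  then have "(\<Sum>k\<in>UNIV. \<bar>f k\<bar>) \<le> of_nat CARD('n) * \<bar>f l\<bar>"
    by (intro sum_bounded_above) auto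
  then show ?thesis using sum_abs[of f UNIV] that order_trans by blast
qed

text \<open>\<open>R i\<close> is one positive term of the \<open>i\<close>-th diagonal entry, or \<open>0\<close> if there is none to be chosen.
  Negative terms, of which there are at most \<open>n\<close>, consume at most half of it, hence \<open>R i \<le> 2 A\<^sub>i\<^sub>i\<close>; the \<open>n\<close> terms of an
  off-diagonal entry add up to at most \<open>n\<close> times the largest one.  This accounts for the constants
  \<open>2 n\<close> and \<open>(2 m n)\<^sup>2\<close>, which reduce the claim to comparisons of single terms.\<close>

lemma psd_if_terms_dominated:
  fixes Q :: "'n :: finite \<Rightarrow> gpuiseux ^ ('m :: finite) ^ ('m :: finite)" and X :: "'n \<Rightarrow> gpuiseux"
  assumes sym: "\<And>k. transpose (Q k) = Q k"
    and X0: "\<And>k. 0 \<le> X k" and R0: "\<And>i. 0 \<le> R i"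
    and R: "\<And>i. R i = 0 \<or> R i = X (p i) * Q (p i) $ i $ i"
    and diag: "\<And>l i. Q l $ i $ i < 0 \<Longrightarrow> of_nat (2 * CARD('n)) * (X l * (- Q l $ i $ i)) \<le> R i"
    and off: "\<And>l i j. i \<noteq> j \<Longrightarrow>
      of_nat ((2 * CARD('m) * CARD('n))\<^sup>2) * (X l * Q l $ i $ j)\<^sup>2 \<le> R i * R j"
  shows "psd (\<chi> i j. \<Sum>k\<in>UNIV. X k * Q k $ i $ j)" (is "psd ?A")
proof (rule psd_if_minors_dominate)
  let ?n = "of_nat CARD('n) :: gpuiseux" and ?m = "of_nat CARD('m) :: gpuiseux"
  show "transpose ?A = ?A"
    using sym by (auto simp: transpose_def vec_eq_iff)
  have R_le: "R i \<le> 2 * ?A $ i $ i" for i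
  proof -
    have each: "(if k = p i then 2 * ?n * R i else 0) - R i \<le> 2 * ?n * (X k * Q k $ i $ i)" for k
    proof (cases "Q k $ i $ i < 0")
      case True
      have neg: "- R i \<le> 2 * ?n * (X k * Q k $ i $ i)" using diag[OF True] by simp
      have "X k * Q k $ i $ i \<le> 0" using X0 True by (intro mult_nonneg_nonpos) auto
      then have "k = p i \<Longrightarrow> R i = 0" using R[of i] R0[of i] by auto
      then show ?thesis using neg by auto
    next
      case False
      then have "0 \<le> X k * Q k $ i $ i" using X0 by (intro mult_nonneg_nonneg) auto
      then have "0 \<le> 2 * ?n * (X k * Q k $ i $ i)" by (rule mult_nonneg_nonneg[rotated]) simp
      moreover have "k = p i \<Longrightarrow> 2 * ?n * R i \<le> 2 * ?n * (X k * Q k $ i $ i)"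
        using R[of i] \<open>0 \<le> X k * Q k $ i $ i\<close> by (intro mult_left_mono) auto
      moreover have "2 * ?n * R i - R i \<le> 2 * ?n * R i" "- R i \<le> 0"
        using R0[of i] by (simp_all only: diff_le_eq le_add_same_cancel1 neg_le_0_iff_le)
      ultimately have "k = p i \<Longrightarrow> 2 * ?n * R i - R i \<le> 2 * ?n * (X k * Q k $ i $ i)"
        "- R i \<le> 2 * ?n * (X k * Q k $ i $ i)"
        by (blast intro: order_trans)+
      then show ?thesis by (cases "k = p i") (simp_all only: simp_thms if_True if_False diff_0)
    qed
    have "?n * R i = 2 * ?n * R i - ?n * R i" by simp
    also have "\<dots> = (\<Sum>k\<in>UNIV. (if k = p i then 2 * ?n * R i else 0) - R i)"
      by (simp add: sum_subtractf)
    also have "\<dots> \<le> (\<Sum>k\<in>UNIV. 2 * ?n * (X k * Q k $ i $ i))"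
      by (intro sum_mono each)
    also have "\<dots> = 2 * ?n * (\<Sum>k\<in>UNIV. X k * Q k $ i $ i)" by (rule sum_distrib_left[symmetric])
    also have "\<dots> = ?n * (2 * ?A $ i $ i)" by (simp only: vec_lambda_beta mult_ac)
    finally show ?thesis by (simp only: mult_le_cancel_left_pos of_nat_0_less_iff zero_less_card_finite)
  qed
  show "0 \<le> ?A $ i $ i" for i
    using order_trans[OF R0 R_le[of i]] by simp
  show "(?m * ?A $ i $ j)\<^sup>2 \<le> ?A $ i $ i * ?A $ j $ j" if ij: "i \<noteq> j" for i j
  proof -
    obtain l where l: "\<bar>\<Sum>k\<in>UNIV. X k * Q k $ i $ j\<bar> \<le> ?n * \<bar>X l * Q l $ i $ j\<bar>"
      by (rule abs_sum_le_card_mult)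
    have "4 * (?m * ?A $ i $ j)\<^sup>2 = 4 * ?m\<^sup>2 * \<bar>\<Sum>k\<in>UNIV. X k * Q k $ i $ j\<bar>\<^sup>2"
      by (simp add: power_mult_distrib)
    also have "\<dots> \<le> 4 * ?m\<^sup>2 * (?n * \<bar>X l * Q l $ i $ j\<bar>)\<^sup>2"
      by (intro mult_left_mono power_mono l) auto
    also have "\<dots> = of_nat ((2 * CARD('m) * CARD('n))\<^sup>2) * (X l * Q l $ i $ j)\<^sup>2"
      by (simp add: power_mult_distrib mult_ac)
    also have "\<dots> \<le> R i * R j" by (rule off[OF ij])
    also have "\<dots> \<le> (2 * ?A $ i $ i) * (2 * ?A $ j $ j)"
      using R_le R0 order_trans[OF R0 R_le] by (intro mult_mono) auto
    also have "\<dots> = 4 * (?A $ i $ i * ?A $ j $ j)" by (simp only: mult_ac)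
    finally show ?thesis by (simp only: mult_le_cancel_left_pos zero_less_numeral)
  qed
qed

text \<open>The lift follows the direction from \<open>x\<close> to \<open>y\<close> through the powers of \<open>s\<close>.  Every comparison of
  terms holds weakly for the exponents at \<open>x\<close> and strictly for those at \<open>y\<close>, with the same index
  \<open>p i\<close> on the larger side both times; hence it holds with any constant once \<open>s\<close> is large.\<close>

lemma ex_lift:
  fixes Q :: "'n :: finite \<Rightarrow> gpuiseux ^ ('m :: finite) ^ ('m :: finite)"
  assumes sym: "\<And>k. transpose (Q k) = Q k"
    and diag: "\<And>l i. \<lbrakk>l \<in> K; Q l $ i $ i < 0\<rbrakk> \<Longrightarrow> p i \<in> K \<and> 0 < Q (p i) $ i $ i \<and>
      lead_exp (Q l $ i $ i) + x l \<le> lead_exp (Q (p i) $ i $ i) + x (p i) \<and>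
      lead_exp (Q l $ i $ i) + y l < lead_exp (Q (p i) $ i $ i) + y (p i)"
    and off: "\<And>l i j. \<lbrakk>l \<in> K; i \<noteq> j; Q l $ i $ j \<noteq> 0\<rbrakk> \<Longrightarrow>
      p i \<in> K \<and> 0 < Q (p i) $ i $ i \<and> p j \<in> K \<and> 0 < Q (p j) $ j $ j \<and>
      2 * (lead_exp (Q l $ i $ j) + x l)
        \<le> (lead_exp (Q (p i) $ i $ i) + x (p i)) + (lead_exp (Q (p j) $ j $ j) + x (p j)) \<and>
      2 * (lead_exp (Q l $ i $ j) + y l)
        < (lead_exp (Q (p i) $ i $ i) + y (p i)) + (lead_exp (Q (p j) $ j $ j) + y (p j))"
  shows "\<exists>X \<in> spectrahedron Q. (\<chi> k. val (X $ k)) = extend_by_bottom K x"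
proof -
  define M where "M = (\<lambda>s k. monomial (s powr (y k - x k)) (x k))"
  let ?N1 = "2 * CARD('n)" and ?N2 = "(2 * CARD('m) * CARD('n))\<^sup>2"
  have ev1: "\<forall>\<^sub>F s in at_top. l \<in> K \<and> Q l $ i $ i < 0 \<longrightarrow>
    of_nat ?N1 * (M s l * (- Q l $ i $ i)) \<le> M s (p i) * Q (p i) $ i $ i" for l i
  proof (cases "l \<in> K \<and> Q l $ i $ i < 0")
    case True
    have neg: "lead_exp (- Q l $ i $ i) = lead_exp (Q l $ i $ i)"
      by (simp add: lead_exp_def uminus_gpuiseux.rep_eq)
    have "\<forall>\<^sub>F s in at_top. of_nat ?N1 * (M s l * (- Q l $ i $ i)) \<le> M s (p i) * Q (p i) $ i $ i"
      unfolding M_def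
    proof (rule eventually_monomial_dominates)
      show "0 < - Q l $ i $ i" "0 < Q (p i) $ i $ i" "0 < ?N1" using True diag[of l i] by auto
      show "x l + lead_exp (- Q l $ i $ i) \<le> x (p i) + lead_exp (Q (p i) $ i $ i)"
        "x l + (y l - x l) + lead_exp (- Q l $ i $ i)
          < x (p i) + (y (p i) - x (p i)) + lead_exp (Q (p i) $ i $ i)"
        unfolding neg using True diag[of l i] by linarith+
    qed
    then show ?thesis by (rule eventually_mono) simp
  qed auto
  have ev2: "\<forall>\<^sub>F s in at_top. l \<in> K \<and> i \<noteq> j \<and> Q l $ i $ j \<noteq> 0 \<longrightarrow>
    of_nat ?N2 * (M s l * Q l $ i $ j)\<^sup>2
      \<le> (M s (p i) * Q (p i) $ i $ i) * (M s (p j) * Q (p j) $ j $ j)" for l i j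
  proof (cases "l \<in> K \<and> i \<noteq> j \<and> Q l $ i $ j \<noteq> 0")
    case True
    note o = off[of l i j]
    have sq: "(M s l * Q l $ i $ j)\<^sup>2
        = monomial (s powr ((y l - x l) + (y l - x l))) (x l + x l) * (Q l $ i $ j * Q l $ i $ j)" for s
      unfolding powr_add monomial_mult[symmetric] M_def power2_eq_square by (simp only: mult_ac)
    have pr: "(M s (p i) * Q (p i) $ i $ i) * (M s (p j) * Q (p j) $ j $ j)
        = monomial (s powr ((y (p i) - x (p i)) + (y (p j) - x (p j)))) (x (p i) + x (p j))
          * (Q (p i) $ i $ i * Q (p j) $ j $ j)" for s
      unfolding powr_add monomial_mult[symmetric] M_def by (simp only: mult_ac)
    have pos: "0 < Q l $ i $ j * Q l $ i $ j" "0 < Q (p i) $ i $ i * Q (p j) $ j $ j"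
      using o True by (auto simp: zero_less_mult_iff neq_iff)
    have lead: "lead_exp (Q l $ i $ j * Q l $ i $ j) = 2 * lead_exp (Q l $ i $ j)"
      "lead_exp (Q (p i) $ i $ i * Q (p j) $ j $ j) = lead_exp (Q (p i) $ i $ i) + lead_exp (Q (p j) $ j $ j)"
      using pos by (subst lead_exp_mult; force)+
    have "\<forall>\<^sub>F s in at_top. of_nat ?N2 * (M s l * Q l $ i $ j)\<^sup>2
      \<le> (M s (p i) * Q (p i) $ i $ i) * (M s (p j) * Q (p j) $ j $ j)"
      unfolding sq pr
    proof (rule eventually_monomial_dominates[OF pos])
      show "0 < ?N2" by simp
      show "(x l + x l) + lead_exp (Q l $ i $ j * Q l $ i $ j)
          \<le> x (p i) + x (p j) + lead_exp (Q (p i) $ i $ i * Q (p j) $ j $ j)"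
        "(x l + x l) + ((y l - x l) + (y l - x l)) + lead_exp (Q l $ i $ j * Q l $ i $ j)
          < x (p i) + x (p j) + ((y (p i) - x (p i)) + (y (p j) - x (p j)))
            + lead_exp (Q (p i) $ i $ i * Q (p j) $ j $ j)"
        unfolding lead using o True by (simp_all add: algebra_simps)
    qed
    then show ?thesis by (rule eventually_mono) simp
  qed auto
  have "\<forall>\<^sub>F s in at_top. \<forall>l i. l \<in> K \<and> Q l $ i $ i < 0 \<longrightarrow>
    of_nat ?N1 * (M s l * (- Q l $ i $ i)) \<le> M s (p i) * Q (p i) $ i $ i"
    by (intro eventually_all_finite ev1)
  moreover have "\<forall>\<^sub>F s in at_top. \<forall>l i j. l \<in> K \<and> i \<noteq> j \<and> Q l $ i $ j \<noteq> 0 \<longrightarrow>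
    of_nat ?N2 * (M s l * Q l $ i $ j)\<^sup>2
      \<le> (M s (p i) * Q (p i) $ i $ i) * (M s (p j) * Q (p j) $ j $ j)"
    by (intro eventually_all_finite ev2)
  moreover note eventually_gt_at_top[of "0 :: real"]
  ultimately have "\<forall>\<^sub>F s in at_top. (\<forall>l i. l \<in> K \<and> Q l $ i $ i < 0 \<longrightarrow>
      of_nat ?N1 * (M s l * (- Q l $ i $ i)) \<le> M s (p i) * Q (p i) $ i $ i) \<and>
    (\<forall>l i j. l \<in> K \<and> i \<noteq> j \<and> Q l $ i $ j \<noteq> 0 \<longrightarrow>
      of_nat ?N2 * (M s l * Q l $ i $ j)\<^sup>2
        \<le> (M s (p i) * Q (p i) $ i $ i) * (M s (p j) * Q (p j) $ j $ j)) \<and> 0 < s"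
    by (intro eventually_conj)
  from eventually_happens'[OF trivial_limit_at_top_linorder this]
  obtain s where s: "0 < s"
    and s1: "\<And>l i. l \<in> K \<Longrightarrow> Q l $ i $ i < 0 \<Longrightarrow>
      of_nat ?N1 * (M s l * (- Q l $ i $ i)) \<le> M s (p i) * Q (p i) $ i $ i"
    and s2: "\<And>l i j. l \<in> K \<Longrightarrow> i \<noteq> j \<Longrightarrow> Q l $ i $ j \<noteq> 0 \<Longrightarrow>
      of_nat ?N2 * (M s l * Q l $ i $ j)\<^sup>2
        \<le> (M s (p i) * Q (p i) $ i $ i) * (M s (p j) * Q (p j) $ j $ j)"
    by (elim exE conjE) (simp only: simp_thms)
  define X where "X = (\<lambda>k. if k \<in> K then M s k else 0)"
  define R where "R = (\<lambda>i. if p i \<in> K \<and> 0 < Q (p i) $ i $ i then X (p i) * Q (p i) $ i $ i else 0)"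
  have M_pos: "0 < M s k" for k unfolding M_def using s by (intro monomial_pos) simp
  have X0: "0 \<le> X k" for k unfolding X_def using M_pos[of k] by (auto intro: less_imp_le)
  have R0: "0 \<le> R i" for i unfolding R_def using X0[of "p i"] by auto
  have "psd (\<chi> i j. \<Sum>k\<in>UNIV. X k * Q k $ i $ j)"
  proof (rule psd_if_terms_dominated[OF sym X0 R0])
    show "R i = 0 \<or> R i = X (p i) * Q (p i) $ i $ i" for i unfolding R_def by auto
    show "of_nat ?N1 * (X l * (- Q l $ i $ i)) \<le> R i" if "Q l $ i $ i < 0" for l i
    proof (cases "l \<in> K")
      case True
      then have "R i = M s (p i) * Q (p i) $ i $ i" "X l = M s l"
        using diag[OF True that] by (simp_all add: R_def X_def)
      then show ?thesis using s1[OF True that] by simp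
    next
      case False
      then show ?thesis using R0 by (simp add: X_def)
    qed
    show "of_nat ?N2 * (X l * Q l $ i $ j)\<^sup>2 \<le> R i * R j" if "i \<noteq> j" for l i j
    proof (cases "l \<in> K \<and> Q l $ i $ j \<noteq> 0")
      case True
      then have l: "l \<in> K" "Q l $ i $ j \<noteq> 0" by auto
      have "R i = M s (p i) * Q (p i) $ i $ i" "R j = M s (p j) * Q (p j) $ j $ j" "X l = M s l"
        using off[OF l(1) that l(2)] l(1) by (simp_all add: R_def X_def)
      then show ?thesis using s2[OF l(1) that l(2)] by simp
    next
      case False
      then have "X l * Q l $ i $ j = 0" by (auto simp: X_def)
      then have "of_nat ?N2 * (X l * Q l $ i $ j)\<^sup>2 = 0" by (simp only: zero_power2 mult_zero_right)
      also have "0 \<le> R i * R j" by (intro mult_nonneg_nonneg R0)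
      finally show ?thesis .
    qed
  qed
  then have "(\<chi> k. X k) \<in> spectrahedron Q"
    using X0 by (simp add: spectrahedron_def)
  moreover have "(\<chi> k. val ((\<chi> k. X k) $ k)) = extend_by_bottom K x"
    using s by (simp add: vec_eq_iff extend_by_bottom_def X_def M_def lead_monomial)
  ultimately show ?thesis by blast
qed

lemma trop_spectrahedron_subset_val_spectrahedron:
  fixes Q :: "'n :: finite \<Rightarrow> gpuiseux ^ ('m :: {finite, linorder}) ^ ('m :: {finite, linorder})"
  assumes sym: "\<And>k. transpose (Q k) = Q k"
    and generic: "\<And>k i j. \<lbrakk>i \<noteq> j; 0 < Q k $ i $ i; 0 < Q k $ j $ j; Q k $ i $ j \<noteq> 0\<rbrakk> \<Longrightarrow>
      lead_exp (Q k $ i $ i) + lead_exp (Q k $ j $ j) \<noteq> 2 * lead_exp (Q k $ i $ j)"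
    and regular: "\<And>K. K \<noteq> {} \<Longrightarrow>
      regular_set K (stratum K (trop_spectrahedron (\<lambda>k. \<chi> i j. sval (Q k $ i $ j))))"
    and x: "x \<in> trop_spectrahedron (\<lambda>k. \<chi> i j. sval (Q k $ i $ j))" (is "x \<in> ?S")
  shows "x \<in> (\<lambda>X. \<chi> k. val (X $ k)) ` spectrahedron Q"
proof -
  define K where "K = trop_support x"
  define r where "r = (\<lambda>k\<in>K. real_of_ereal (x $ k))"
  have r_in: "r \<in> stratum K ?S" using x unfolding stratum_def r_def K_def by blast
  have extend: "extend_by_bottom K (\<lambda>k\<in>K. real_of_ereal (z $ k)) = z"
    if "z \<in> ?S" "trop_support z = K" for z
  proof -
    have "ereal (real_of_ereal (z $ k)) = z $ k" if "k \<in> K" for k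
      using \<open>z \<in> ?S\<close> \<open>trop_support z = K\<close> that
      by (intro ereal_real') (auto simp: trop_spectrahedron_def trop_support_def)
    moreover have "z $ k = - \<infinity>" if "k \<notin> K" for k
      using \<open>trop_support z = K\<close> that by (auto simp: trop_support_def)
    ultimately show ?thesis by (simp add: vec_eq_iff extend_by_bottom_def)
  qed
  have x_eq: "extend_by_bottom K r = x" unfolding r_def using extend x K_def by blast
  have ineqs: "satisfies_trop_ineqs Q K z" if "z \<in> stratum K ?S" for z
  proof -
    obtain u where "z = (\<lambda>k\<in>K. real_of_ereal (u $ k))" "u \<in> ?S" "trop_support u = K"
      using \<open>z \<in> stratum K ?S\<close> unfolding stratum_def by blast
    then have "extend_by_bottom K z \<in> ?S" using extend by simp
    then show ?thesis by (rule satisfies_trop_ineqs_if_extend_by_bottom[OF sym])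
  qed
  obtain \<delta> where \<delta>: "0 < \<delta>" and near: "\<And>y i p. \<lbrakk>\<And>k. k \<in> K \<Longrightarrow> \<bar>y k - r k\<bar> < \<delta>; dominant Q K y i p\<rbrakk>
      \<Longrightarrow> dominant Q K r i p"
    using dominant_nearby[of K r Q] by blast
  obtain y where y_near: "\<And>k. k \<in> K \<Longrightarrow> \<bar>y k - r k\<bar> < \<delta>"
    and bump: "\<And>l. l \<in> K \<Longrightarrow> \<exists>h>0. satisfies_trop_ineqs Q K (y(l := y l + h))"
  proof (cases "K = {}")
    case True
    then show ?thesis using that[of r] by simp
  next
    case False
    obtain y where y: "y \<in> powertop_real K interior_of (stratum K ?S)"
      "\<And>k. k \<in> K \<Longrightarrow> \<bar>y k - r k\<bar> < \<delta>"
      using ex_interior_near[OF regular[OF False] r_in \<delta>] by blast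
    have "\<exists>h>0. satisfies_trop_ineqs Q K (y(l := y l + h))" if l: "l \<in> K" for l
    proof -
      obtain h where h: "0 < h" "y(l := y l + h) \<in> stratum K ?S"
        by (rule interior_bump[OF y(1) l])
      show ?thesis using h(1) ineqs[OF h(2)] by (intro exI[of _ h] conjI)
    qed
    then show ?thesis using y(2) by (intro that[of y])
  qed
  define p where "p = (\<lambda>i. SOME p. dominant Q K y i p)"
  have p: "dominant Q K y i (p i)" if "k \<in> K" "0 < Q k $ i $ i" for i k
    unfolding p_def using ex_dominant[where Q = Q, OF that] by (rule someI_ex)
  have p_r: "dominant Q K r i (p i)" if "k \<in> K" "0 < Q k $ i $ i" for i k
    using y_near p[OF that] by (rule near[of y])
  have r_ineqs: "satisfies_trop_ineqs Q K r" by (rule ineqs[OF r_in])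
  have "\<exists>X \<in> spectrahedron Q. (\<chi> k. val (X $ k)) = extend_by_bottom K r"
  proof (rule ex_lift[OF sym, where p = p and y = y])
    fix l i assume l: "l \<in> K" "Q l $ i $ i < 0"
    obtain k where k: "k \<in> K" "0 < Q k $ i $ i"
      "lead_exp (Q l $ i $ i) + r l \<le> lead_exp (Q k $ i $ i) + r k"
      by (rule satisfies_trop_ineqs_diagE[OF r_ineqs l])
    obtain h where h: "0 < h" "satisfies_trop_ineqs Q K (y(l := y l + h))" using bump[OF l(1)] by blast
    have "lead_exp (Q l $ i $ i) + r l \<le> lead_exp (Q (p i) $ i $ i) + r (p i)"
      using k(3) dominantD(3)[OF p_r[OF k(1,2)] k(1,2)] by (rule order_trans)
    then show "p i \<in> K \<and> 0 < Q (p i) $ i $ i \<and>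
      lead_exp (Q l $ i $ i) + r l \<le> lead_exp (Q (p i) $ i $ i) + r (p i) \<and>
      lead_exp (Q l $ i $ i) + y l < lead_exp (Q (p i) $ i $ i) + y (p i)"
      using dominant_strict_diag[OF h l p[OF k(1,2)]] dominantD(1,2)[OF p[OF k(1,2)]]
      by (intro conjI)
  next
    fix l i j assume l: "l \<in> K" "i \<noteq> j" "Q l $ i $ j \<noteq> 0"
    obtain k k' where k: "k \<in> K" "0 < Q k $ i $ i" and k': "k' \<in> K" "0 < Q k' $ j $ j"
      and le: "2 * (lead_exp (Q l $ i $ j) + r l)
        \<le> (lead_exp (Q k $ i $ i) + r k) + (lead_exp (Q k' $ j $ j) + r k')"
      by (rule satisfies_trop_ineqs_offdiagE[OF r_ineqs l])
    obtain h where h: "0 < h" "satisfies_trop_ineqs Q K (y(l := y l + h))" using bump[OF l(1)] by blast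
    have "2 * (lead_exp (Q l $ i $ j) + r l)
        \<le> (lead_exp (Q (p i) $ i $ i) + r (p i)) + (lead_exp (Q (p j) $ j $ j) + r (p j))"
      using le add_mono[OF dominantD(3)[OF p_r[OF k] k] dominantD(3)[OF p_r[OF k'] k']]
      by (rule order_trans)
    then show "p i \<in> K \<and> 0 < Q (p i) $ i $ i \<and> p j \<in> K \<and> 0 < Q (p j) $ j $ j \<and>
      2 * (lead_exp (Q l $ i $ j) + r l)
        \<le> (lead_exp (Q (p i) $ i $ i) + r (p i)) + (lead_exp (Q (p j) $ j $ j) + r (p j)) \<and>
      2 * (lead_exp (Q l $ i $ j) + y l)
        < (lead_exp (Q (p i) $ i $ i) + y (p i)) + (lead_exp (Q (p j) $ j $ j) + y (p j))"
      using dominant_strict_offdiag[OF h l generic[OF l(2) _ _ l(3)] p[OF k] p[OF k']]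
        dominantD(1,2)[OF p[OF k]] dominantD(1,2)[OF p[OF k']]
      by (intro conjI)
  qed
  then obtain X where "X \<in> spectrahedron Q" "(\<chi> k. val (X $ k)) = x"
    unfolding x_eq by (elim bexE)
  then show ?thesis by (intro image_eqI[of _ _ X]) simp_all
qed

theorem theorem5p13:
  fixes Q :: "'n :: finite \<Rightarrow> gpuiseux ^ ('m :: {finite, linorder}) ^ ('m :: {finite, linorder})"
    and TQ :: "'n \<Rightarrow> signed_trop ^ ('m :: {finite, linorder}) ^ ('m :: {finite, linorder})"
  assumes "\<And>k. transpose (Q k) = Q k"
    and "\<And>k. metzler (Q k)"
    and "TQ = (\<lambda>k. \<chi> i j. sval (Q k $ i $ j))"
    and "\<And>k i j. \<lbrakk>i \<noteq> j; TQ k $ i $ i \<in> trop_pos; TQ k $ j $ j \<in> trop_pos\<rbrakk> \<Longrightarrow>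
           modulus (TQ k $ i $ i) + modulus (TQ k $ j $ j) \<noteq> 2 * modulus (TQ k $ i $ j)"
    and "\<And>K. K \<noteq> {} \<Longrightarrow> regular_set K (stratum K (trop_spectrahedron TQ))"
  shows "(\<lambda>x. \<chi> k. val (x $ k)) ` spectrahedron Q = trop_spectrahedron TQ"
proof
  show "(\<lambda>x. \<chi> k. val (x $ k)) ` spectrahedron Q \<subseteq> trop_spectrahedron TQ"
    unfolding assms(3) using val_spectrahedron_in_trop_spectrahedron[where Q = Q, OF assms(2)] by blast
  have generic: "lead_exp (Q k $ i $ i) + lead_exp (Q k $ j $ j) \<noteq> 2 * lead_exp (Q k $ i $ j)"
    if "i \<noteq> j" "0 < Q k $ i $ i" "0 < Q k $ j $ j" "Q k $ i $ j \<noteq> 0" for k i j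
  proof -
    have "val (Q k $ i $ i) + val (Q k $ j $ j) \<noteq> 2 * val (Q k $ i $ j)"
      using assms(4)[OF that(1), of k] that(2,3)
      unfolding assms(3) vec_lambda_beta modulus_sval by (simp add: trop_pos_def sval_def)
    moreover have "Q k $ i $ i \<noteq> 0" "Q k $ j $ j \<noteq> 0" using that(2,3) by auto
    ultimately show ?thesis using that(4) by (simp add: val_def)
  qed
  show "trop_spectrahedron TQ \<subseteq> (\<lambda>x. \<chi> k. val (x $ k)) ` spectrahedron Q"
    using trop_spectrahedron_subset_val_spectrahedron[where Q = Q, OF assms(1) generic assms(5)[unfolded assms(3)]]
    unfolding assms(3) by blast
qed

end
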